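(* Let $G$ be a Lie group with Lie algebra $\mathfrak{g}$, let $g$ be a left invariant Riemannian metric on $G$ and $X$ a left invariant vector field on $G$, and suppose that the left invariant Matsumoto metric $F(x,y)=\dfrac{g(y,y)}{\sqrt{g(y,y)}-g(X(x),y)}$ is a Finsler metric of Berwald type. Let $(P,y)$ be a flag in $\mathfrak{g}$ such that $\{v,y\}$ is an orthonormal basis of $P$ with respect to $g$. Then the flag curvature of $F$ satisfies $$K^F(P,y)=\frac{2-F}{F^2\left(2F^2\,g(X,v)^2+2-F\right)}\,K^g(P),$$ where $F=F(y)$ and $K^g$ denotes the sectional curvature of the Riemannian metric $g$.
   Context: A Finsler metric on a manifold $M$ is a function $F:TM\to[0,\infty)$, smooth on $TM\setminus\{0\}$, with $F(x,\lambda y)=\lambda F(x,y)$ for $\lambda>0$, and with $\left(\frac12\frac{\partial^2F^2}{\partial y^i\partial y^j}\right)$ positive definite on $TM\setminus\{0\}$. On a Lie group $G$, $F$ is left invariant if $F(x,y)=F(e,dl_{x^{-1}}y)$ for all $x\in G$, $y\in T_xG$. The Matsumoto metric above is a Finsler metric if and only if $\sqrt{g(X,X)}<\frac12$. Left invariant objects are identified with their values on $\mathfrak{g}=T_eG$. $F$ is of Berwald type if, in standard local coordinates on $TM\setminus\{0\}$, the Christoffel symbols $\Gamma^i_{jk}$ of its Chern connection do not depend on $y$. A flag $(P,y)$ consists of a 2-dimensional subspace $P$ and a nonzero vector $y\in P$. The flag curvature is $$K^F(P,y)=\frac{g_y(R_y(u),u)}{g_y(y,y)g_y(u,u)-g_y(y,u)^2},$$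 where $P=\mathrm{span}\{u,y\}$, $g_y(u,v)=\frac12\frac{\partial^2}{\partial s\,\partial t}F^2(y+su+tv)\big|_{s=t=0}$, $R_y(u)=R(u,y)y=\nabla_u\nabla_yy-\nabla_y\nabla_uy-\nabla_{[u,y]}y$ and $\nabla$ is the Chern connection of $F$. *)

theory Defs
  imports "HOL-Analysis.Analysis" "HOL-Algebra.Group" "HOL-Library.Function_Algebras"
begin

fun Ck_on :: "nat \<Rightarrow> ('a::real_normed_vector \<Rightarrow> 'b::real_normed_vector) \<Rightarrow> 'a set \<Rightarrow> bool" where
  "Ck_on 0 f S \<longleftrightarrow> continuous_on S f"
| "Ck_on (Suc k) f S \<longleftrightarrow>
     (\<forall>x\<in>S. f differentiable (at x)) \<and> (\<forall>v. Ck_on k (\<lambda>x. frechet_derivative f (at x) v) S)"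

text \<open>Meaningful for open sets only.\<close>

definition smooth_on :: "('a::real_normed_vector \<Rightarrow> 'b::real_normed_vector) \<Rightarrow> 'a set \<Rightarrow> bool" where
  "smooth_on f S \<longleftrightarrow> (\<forall>k. Ck_on k f S)"

text \<open>A chart is a pair of its domain and its coordinate map; the values of the coordinate map
  outside the domain are irrelevant.\<close>

type_synonym ('a, 'e) chart = "'a set \<times> ('a \<Rightarrow> 'e)"

definition chart_image :: "('a, 'e) chart \<Rightarrow> 'e set" where
  "chart_image c = snd c ` fst c"

definition chart_pt :: "('a, 'e) chart \<Rightarrow> 'e \<Rightarrow> 'a" where
  "chart_pt c = inv_into (fst c) (snd c)"

definition smooth_manifold :: "'a topology \<Rightarrow> ('a, 'e::euclidean_space) chart set \<Rightarrow> bool" where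
  "smooth_manifold T A \<longleftrightarrow>
     Hausdorff_space T \<and> second_countable T \<and> topspace T = (\<Union>c\<in>A. fst c) \<and>
     (\<forall>c\<in>A. openin T (fst c) \<and> open (chart_image c) \<and>
        homeomorphic_map (subtopology T (fst c)) (top_of_set (chart_image c)) (snd c)) \<and>
     (\<forall>c\<in>A. \<forall>d\<in>A. smooth_on (snd d \<circ> chart_pt c) (snd c ` (fst c \<inter> fst d)))"

definition smooth_map ::
  "'a topology \<Rightarrow> ('a, 'e::euclidean_space) chart set \<Rightarrow>
   'b topology \<Rightarrow> ('b, 'f::euclidean_space) chart set \<Rightarrow> ('a \<Rightarrow> 'b) \<Rightarrow> bool" where
  "smooth_map T A T' A' f \<longleftrightarrow> continuous_map T T' f \<and>
     (\<forall>c\<in>A. \<forall>d\<in>A'. smooth_on (snd d \<circ> f \<circ> chart_pt c) (snd c ` {p \<in> fst c. f p \<in> fst d}))"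

definition prod_atlas ::
  "('a, 'e) chart set \<Rightarrow> ('b, 'f) chart set \<Rightarrow> ('a \<times> 'b, 'e \<times> 'f) chart set" where
  "prod_atlas A B = {(fst c \<times> fst d, map_prod (snd c) (snd d)) | c d. c \<in> A \<and> d \<in> B}"

definition lie_group ::
  "('a, 'm) monoid_scheme \<Rightarrow> 'a topology \<Rightarrow> ('a, 'e::euclidean_space) chart set \<Rightarrow> bool" where
  "lie_group G T A \<longleftrightarrow> group G \<and> topspace T = carrier G \<and> smooth_manifold T A \<and>
     smooth_map (prod_topology T T) (prod_atlas A A) T A (\<lambda>(x, y). x \<otimes>\<^bsub>G\<^esub> y) \<and>
     smooth_map T A T A (\<lambda>x. inv\<^bsub>G\<^esub> x)"

text \<open>A tangent vector at \<open>p\<close> is the family of its component vectors in all charts around \<open>p\<close>,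
  subject to the usual transformation law, and extended by \<open>0\<close> to the other indices.
  Vector space operations are componentwise.\<close>

instantiation "fun" :: (type, real_vector) real_vector
begin

definition scaleR_fun :: "real \<Rightarrow> ('a \<Rightarrow> 'b) \<Rightarrow> 'a \<Rightarrow> 'b" where
  "scaleR_fun r f = (\<lambda>x. r *\<^sub>R f x)"

instance
  by standard (auto simp: scaleR_fun_def fun_eq_iff algebra_simps)

end

type_synonym ('a, 'e) tvec = "('a, 'e) chart \<Rightarrow> 'e"

definition tangent_space ::
  "('a, 'e::euclidean_space) chart set \<Rightarrow> 'a \<Rightarrow> ('a, 'e) tvec set" where
  "tangent_space A p = {\<xi>.
     (\<forall>c\<in>A. \<forall>d\<in>A. p \<in> fst c \<longrightarrow> p \<in> fst d \<longrightarrow>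
        \<xi> d = frechet_derivative (snd d \<circ> chart_pt c) (at (snd c p)) (\<xi> c)) \<and>
     (\<forall>c. \<not> (c \<in> A \<and> p \<in> fst c) \<longrightarrow> \<xi> c = 0)}"

text \<open>The tangent vector at \<open>p\<close> whose components in the chart \<open>c\<close> are \<open>w\<close>.\<close>

definition chart_vec ::
  "('a, 'e::euclidean_space) chart set \<Rightarrow> ('a, 'e) chart \<Rightarrow> 'a \<Rightarrow> 'e \<Rightarrow> ('a, 'e) tvec" where
  "chart_vec A c p w = (\<lambda>d. if d \<in> A \<and> p \<in> fst d
     then frechet_derivative (snd d \<circ> chart_pt c) (at (snd c p)) w else 0)"

text \<open>The differential of \<open>f\<close> at \<open>p\<close>; for smooth \<open>f\<close> and a tangent vector \<open>\<xi>\<close> at \<open>p\<close> the chosen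
  chart \<open>c\<close> is immaterial.\<close>

definition tangent_map ::
  "('a, 'e::euclidean_space) chart set \<Rightarrow> ('b, 'f::euclidean_space) chart set \<Rightarrow> ('a \<Rightarrow> 'b) \<Rightarrow>
   'a \<Rightarrow> ('a, 'e) tvec \<Rightarrow> ('b, 'f) tvec" where
  "tangent_map A A' f p \<xi> = (\<lambda>d. if d \<in> A' \<and> f p \<in> fst d
     then let c = (SOME c. c \<in> A \<and> p \<in> fst c)
          in frechet_derivative (snd d \<circ> f \<circ> chart_pt c) (at (snd c p)) (\<xi> c)
     else 0)"

definition coord_metric ::
  "('a, real^'n) chart set \<Rightarrow> ('a, real^'n) chart \<Rightarrow>
   ('a \<Rightarrow> ('a, real^'n) tvec \<Rightarrow> ('a, real^'n) tvec \<Rightarrow> real) \<Rightarrow> real^'n \<Rightarrow> real^'n^'n" where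
  "coord_metric A c g x = (\<chi> i j. g (chart_pt c x)
     (chart_vec A c (chart_pt c x) (axis i 1)) (chart_vec A c (chart_pt c x) (axis j 1)))"

definition riemannian_metric ::
  "('a, real^'n) chart set \<Rightarrow>
   ('a \<Rightarrow> ('a, real^'n) tvec \<Rightarrow> ('a, real^'n) tvec \<Rightarrow> real) \<Rightarrow> bool" where
  "riemannian_metric A g \<longleftrightarrow>
     (\<forall>p \<in> (\<Union>c\<in>A. fst c).
        (\<forall>\<xi>\<in>tangent_space A p. \<forall>\<eta>\<in>tangent_space A p. g p \<xi> \<eta> = g p \<eta> \<xi>) \<and>
        (\<forall>\<xi>\<in>tangent_space A p. \<forall>\<eta>\<in>tangent_space A p. \<forall>\<zeta>\<in>tangent_space A p. \<forall>a b.
           g p (a *\<^sub>R \<xi> + b *\<^sub>R \<eta>) \<zeta> = a * g p \<xi> \<zeta> + b * g p \<eta> \<zeta>) \<and>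
        (\<forall>\<xi>\<in>tangent_space A p. \<xi> \<noteq> 0 \<longrightarrow> g p \<xi> \<xi> > 0)) \<and>
     (\<forall>c\<in>A. \<forall>i j. smooth_on (\<lambda>x. coord_metric A c g x $ i $ j) (chart_image c))"

definition vector_field ::
  "('a, 'e::euclidean_space) chart set \<Rightarrow> ('a \<Rightarrow> ('a, 'e) tvec) \<Rightarrow> bool" where
  "vector_field A X \<longleftrightarrow> (\<forall>p \<in> (\<Union>c\<in>A. fst c). X p \<in> tangent_space A p) \<and>
     (\<forall>c\<in>A. smooth_on (\<lambda>x. X (chart_pt c x) c) (chart_image c))"

definition left_invariant_metric ::
  "('a, 'm) monoid_scheme \<Rightarrow> ('a, real^'n) chart set \<Rightarrow>
   ('a \<Rightarrow> ('a, real^'n) tvec \<Rightarrow> ('a, real^'n) tvec \<Rightarrow> real) \<Rightarrow> bool" where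
  "left_invariant_metric G A g \<longleftrightarrow>
     (\<forall>x\<in>carrier G. \<forall>\<xi>\<in>tangent_space A x. \<forall>\<eta>\<in>tangent_space A x.
        g x \<xi> \<eta> = g \<one>\<^bsub>G\<^esub> (tangent_map A A (\<lambda>z. inv\<^bsub>G\<^esub> x \<otimes>\<^bsub>G\<^esub> z) x \<xi>)
                      (tangent_map A A (\<lambda>z. inv\<^bsub>G\<^esub> x \<otimes>\<^bsub>G\<^esub> z) x \<eta>))"

definition left_invariant_field ::
  "('a, 'm) monoid_scheme \<Rightarrow> ('a, 'e::euclidean_space) chart set \<Rightarrow> ('a \<Rightarrow> ('a, 'e) tvec) \<Rightarrow> bool" where
  "left_invariant_field G A X \<longleftrightarrow>
     (\<forall>a\<in>carrier G. \<forall>x\<in>carrier G. tangent_map A A (\<lambda>z. a \<otimes>\<^bsub>G\<^esub> z) x (X x) = X (a \<otimes>\<^bsub>G\<^esub> x))"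

text \<open>\<open>fund_tensor N y u v\<close> is \<open>g\<^sub>y(u, v)\<close> for the Finsler function \<open>N\<close> of a single tangent space.\<close>

definition fund_tensor :: "('v::real_vector \<Rightarrow> real) \<Rightarrow> 'v \<Rightarrow> 'v \<Rightarrow> 'v \<Rightarrow> real" where
  "fund_tensor N y u v =
     1/2 * deriv (\<lambda>s. deriv (\<lambda>t. (N (y + s *\<^sub>R u + t *\<^sub>R v))\<^sup>2) 0) 0"

text \<open>Below, \<open>L x y\<close> is a Finsler function in coordinates. The entries are
  \<open>g\<^sub>i\<^sub>j = 1/2 \<partial>\<^sup>2L\<^sup>2/\<partial>y\<^sup>i\<partial>y\<^sup>j\<close>.\<close>

definition fund_matrix :: "(real^'n \<Rightarrow> real^'n \<Rightarrow> real) \<Rightarrow> real^'n \<Rightarrow> real^'n \<Rightarrow> real^'n^'n" where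
  "fund_matrix L x y = (\<chi> i j. fund_tensor (L x) y (axis i 1) (axis j 1))"

definition coord_finsler ::
  "('a, real^'n) chart set \<Rightarrow> ('a, real^'n) chart \<Rightarrow> ('a \<Rightarrow> ('a, real^'n) tvec \<Rightarrow> real) \<Rightarrow>
   real^'n \<Rightarrow> real^'n \<Rightarrow> real" where
  "coord_finsler A c F x y = F (chart_pt c x) (chart_vec A c (chart_pt c x) y)"

definition finsler_metric ::
  "('a, real^'n) chart set \<Rightarrow> ('a \<Rightarrow> ('a, real^'n) tvec \<Rightarrow> real) \<Rightarrow> bool" where
  "finsler_metric A F \<longleftrightarrow>
     (\<forall>p \<in> (\<Union>c\<in>A. fst c). \<forall>\<xi>\<in>tangent_space A p.
        F p \<xi> \<ge> 0 \<and> (\<forall>r>0. F p (r *\<^sub>R \<xi>) = r * F p \<xi>)) \<and>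
     (\<forall>c\<in>A.
        smooth_on (\<lambda>(x, y). coord_finsler A c F x y) (chart_image c \<times> (UNIV - {0})) \<and>
        (\<forall>x\<in>chart_image c. \<forall>y. y \<noteq> 0 \<longrightarrow>
           (\<forall>w. w \<noteq> 0 \<longrightarrow> w \<bullet> (fund_matrix (coord_finsler A c F) x y *v w) > 0)))"

definition left_invariant_finsler ::
  "('a, 'm) monoid_scheme \<Rightarrow> ('a, real^'n) chart set \<Rightarrow> ('a \<Rightarrow> ('a, real^'n) tvec \<Rightarrow> real) \<Rightarrow> bool" where
  "left_invariant_finsler G A F \<longleftrightarrow>
     (\<forall>x\<in>carrier G. \<forall>\<xi>\<in>tangent_space A x.
        F x \<xi> = F \<one>\<^bsub>G\<^esub> (tangent_map A A (\<lambda>z. inv\<^bsub>G\<^esub> x \<otimes>\<^bsub>G\<^esub> z) x \<xi>))"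

definition matsumoto ::
  "('a \<Rightarrow> 'v \<Rightarrow> 'v \<Rightarrow> real) \<Rightarrow> ('a \<Rightarrow> 'v) \<Rightarrow> 'a \<Rightarrow> 'v \<Rightarrow> real" where
  "matsumoto g X x y = g x y y / (sqrt (g x y y) - g x (X x) y)"

definition partial :: "'n \<Rightarrow> (real^'n \<Rightarrow> real) \<Rightarrow> real^'n \<Rightarrow> real" where
  "partial k f x = deriv (\<lambda>t. f (x + t *\<^sub>R axis k 1)) 0"

text \<open>Geodesic coefficients, normalised so that geodesics satisfy \<open>x'' + 2 G(x, x') = 0\<close>:
  \<open>G\<^sup>i = 1/4 g\<^sup>i\<^sup>l (y\<^sup>k \<partial>\<^sup>2L\<^sup>2/\<partial>x\<^sup>k\<partial>y\<^sup>l - \<partial>L\<^sup>2/\<partial>x\<^sup>l)\<close>.\<close>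

definition spray :: "(real^'n \<Rightarrow> real^'n \<Rightarrow> real) \<Rightarrow> 'n \<Rightarrow> real^'n \<Rightarrow> real^'n \<Rightarrow> real" where
  "spray L i x y = 1/4 * (\<Sum>l\<in>UNIV. matrix_inv (fund_matrix L x y) $ i $ l *
     ((\<Sum>k\<in>UNIV. partial k (\<lambda>x'. partial l (\<lambda>y'. (L x' y')\<^sup>2) y) x * y $ k)
      - partial l (\<lambda>x'. (L x' y)\<^sup>2) x))"

definition nonlin_conn ::
  "(real^'n \<Rightarrow> real^'n \<Rightarrow> real) \<Rightarrow> 'n \<Rightarrow> 'n \<Rightarrow> real^'n \<Rightarrow> real^'n \<Rightarrow> real" where
  "nonlin_conn L i j x y = partial j (\<lambda>y'. spray L i x y') y"

text \<open>Horizontal derivative along \<open>\<delta>/\<delta>x\<^sup>k = \<partial>/\<partial>x\<^sup>k - N\<^sup>m\<^sub>k \<partial>/\<partial>y\<^sup>m\<close>.\<close>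

definition horiz_deriv ::
  "(real^'n \<Rightarrow> real^'n \<Rightarrow> real) \<Rightarrow> 'n \<Rightarrow> (real^'n \<Rightarrow> real^'n \<Rightarrow> real) \<Rightarrow> real^'n \<Rightarrow> real^'n \<Rightarrow> real" where
  "horiz_deriv L k f x y = partial k (\<lambda>x'. f x' y) x
     - (\<Sum>m\<in>UNIV. nonlin_conn L m k x y * partial m (\<lambda>y'. f x y') y)"

text \<open>\<open>chern L i j k\<close> is \<open>\<Gamma>\<^sup>i\<^sub>j\<^sub>k\<close>.\<close>

definition chern ::
  "(real^'n \<Rightarrow> real^'n \<Rightarrow> real) \<Rightarrow> 'n \<Rightarrow> 'n \<Rightarrow> 'n \<Rightarrow> real^'n \<Rightarrow> real^'n \<Rightarrow> real" where
  "chern L i j k x y = 1/2 * (\<Sum>s\<in>UNIV. matrix_inv (fund_matrix L x y) $ i $ s *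
     (horiz_deriv L k (\<lambda>x y. fund_matrix L x y $ s $ j) x y
      - horiz_deriv L s (\<lambda>x y. fund_matrix L x y $ j $ k) x y
      + horiz_deriv L j (\<lambda>x y. fund_matrix L x y $ k $ s) x y))"

definition berwald_type ::
  "('a, real^'n) chart set \<Rightarrow> ('a \<Rightarrow> ('a, real^'n) tvec \<Rightarrow> real) \<Rightarrow> bool" where
  "berwald_type A F \<longleftrightarrow>
     (\<forall>c\<in>A. \<forall>x\<in>chart_image c. \<forall>i j k. \<forall>y y'. y \<noteq> 0 \<longrightarrow> y' \<noteq> 0 \<longrightarrow>
        chern (coord_finsler A c F) i j k x y = chern (coord_finsler A c F) i j k x y')"

text \<open>Chern covariant derivative of a section \<open>W\<close> of the pulled back tangent bundle along the
  horizontal lift of the constant coefficient field \<open>u\<close>.\<close>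

definition chern_deriv ::
  "(real^'n \<Rightarrow> real^'n \<Rightarrow> real) \<Rightarrow> real^'n \<Rightarrow> (real^'n \<Rightarrow> real^'n \<Rightarrow> real^'n) \<Rightarrow>
   real^'n \<Rightarrow> real^'n \<Rightarrow> real^'n" where
  "chern_deriv L u W x y = (\<chi> i. \<Sum>k\<in>UNIV. u $ k *
     (horiz_deriv L k (\<lambda>x y. W x y $ i) x y + (\<Sum>j\<in>UNIV. chern L i j k x y * W x y $ j)))"

text \<open>The curvature \<open>R(u, v)w = \<nabla>\<^sub>u\<nabla>\<^sub>v w - \<nabla>\<^sub>v\<nabla>\<^sub>u w - \<nabla>\<^bsub>[u,v]\<^esub> w\<close> of the Chern connection at \<open>(x, y)\<close>.
  It is tensorial, so \<open>u\<close>, \<open>v\<close>, \<open>w\<close> are extended with constant coefficients. The last term then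
  vanishes: the bracket of the horizontal lifts is vertical, and the Chern connection
  annihilates \<open>w\<close> in vertical directions.\<close>

definition chern_curv ::
  "(real^'n \<Rightarrow> real^'n \<Rightarrow> real) \<Rightarrow> real^'n \<Rightarrow> real^'n \<Rightarrow> real^'n \<Rightarrow> real^'n \<Rightarrow> real^'n \<Rightarrow> real^'n" where
  "chern_curv L x y u v w =
     chern_deriv L u (chern_deriv L v (\<lambda>_ _. w)) x y - chern_deriv L v (chern_deriv L u (\<lambda>_ _. w)) x y"

definition flag ::
  "('a, 'e::euclidean_space) chart set \<Rightarrow> 'a \<Rightarrow> ('a, 'e) tvec set \<Rightarrow> ('a, 'e) tvec \<Rightarrow> bool" where
  "flag A p P y \<longleftrightarrow> subspace P \<and> P \<subseteq> tangent_space A p \<and> dim P = 2 \<and> y \<in> P \<and> y \<noteq> 0"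

text \<open>The flag curvature at \<open>p\<close>, computed in a chart \<open>c\<close> around \<open>p\<close>. By tensoriality it does not
  depend on \<open>c\<close>, which nevertheless is kept as a parameter; nor does it depend on \<open>u\<close>.\<close>

definition flag_curvature ::
  "('a, real^'n) chart set \<Rightarrow> ('a, real^'n) chart \<Rightarrow> ('a \<Rightarrow> ('a, real^'n) tvec \<Rightarrow> real) \<Rightarrow>
   'a \<Rightarrow> ('a, real^'n) tvec set \<Rightarrow> ('a, real^'n) tvec \<Rightarrow> real" where
  "flag_curvature A c F p P y = (THE K. \<forall>u. span {u, y} = P \<longrightarrow>
     (let L = coord_finsler A c F; x = snd c p; gy = fund_tensor (L x) (y c)
      in K = gy (chern_curv L x (y c) (u c) (y c) (y c)) (u c)
             / (gy (y c) (y c) * gy (u c) (u c) - (gy (y c) (u c))\<^sup>2)))"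

definition levi_civita ::
  "(real^'n \<Rightarrow> real^'n^'n) \<Rightarrow> 'n \<Rightarrow> 'n \<Rightarrow> 'n \<Rightarrow> real^'n \<Rightarrow> real" where
  "levi_civita h i j k x = 1/2 * (\<Sum>s\<in>UNIV. matrix_inv (h x) $ i $ s *
     (partial k (\<lambda>x. h x $ s $ j) x - partial s (\<lambda>x. h x $ j $ k) x + partial j (\<lambda>x. h x $ k $ s) x))"

definition lc_deriv ::
  "(real^'n \<Rightarrow> real^'n^'n) \<Rightarrow> real^'n \<Rightarrow> (real^'n \<Rightarrow> real^'n) \<Rightarrow> real^'n \<Rightarrow> real^'n" where
  "lc_deriv h u W x = (\<chi> i. \<Sum>k\<in>UNIV. u $ k *
     (partial k (\<lambda>x. W x $ i) x + (\<Sum>j\<in>UNIV. levi_civita h i j k x * W x $ j)))"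

definition riemann_curv ::
  "(real^'n \<Rightarrow> real^'n^'n) \<Rightarrow> real^'n \<Rightarrow> real^'n \<Rightarrow> real^'n \<Rightarrow> real^'n \<Rightarrow> real^'n" where
  "riemann_curv h x u v w =
     lc_deriv h u (lc_deriv h v (\<lambda>_. w)) x - lc_deriv h v (lc_deriv h u (\<lambda>_. w)) x"

definition sectional_curvature ::
  "('a, real^'n) chart set \<Rightarrow> ('a, real^'n) chart \<Rightarrow>
   ('a \<Rightarrow> ('a, real^'n) tvec \<Rightarrow> ('a, real^'n) tvec \<Rightarrow> real) \<Rightarrow>
   'a \<Rightarrow> ('a, real^'n) tvec set \<Rightarrow> real" where
  "sectional_curvature A c g p P = (THE K. \<forall>u v. span {u, v} = P \<longrightarrow>
     (let h = coord_metric A c g; x = snd c p; ip = (\<lambda>a b. a \<bullet> (h x *v b))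
      in K = ip (riemann_curv h x (u c) (v c) (v c)) (u c)
             / (ip (u c) (u c) * ip (v c) (v c) - (ip (u c) (v c))\<^sup>2)))"

end

theory Submission
  imports Defs
begin

text \<open>
  Write \<open>\<alpha>\<close> for the Riemannian norm and \<open>\<beta> = g(X, \<cdot>)\<close>, so that \<open>F = \<alpha>\<^sup>2 / (\<alpha> - \<beta>)\<close>. The formula rests on the fact
  that Berwald type forces \<open>\<beta>\<close> to be parallel and the Chern connection of \<open>F\<close> to be the Levi-Civita
  connection of \<open>g\<close>.

  For any Finsler function the horizontal derivatives annihilate \<open>F\<^sup>2\<close> (\<open>energy_horizontal\<close>), and the
  nonlinear connection is \<open>N\<^sup>i\<^sub>k = \<Gamma>\<^sup>i\<^sub>j\<^sub>k y\<^sup>j\<close> (\<open>chern_radial\<close>). If \<open>\<Gamma>\<close> depends on the base point alone,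
  \<open>N\<close> is linear in \<open>y\<close>; hence the horizontal derivative in a coordinate direction turns \<open>\<alpha>\<^sup>2\<close> into a
  quadratic form \<open>q\<close> in \<open>y\<close> and \<open>\<beta>\<close> into a linear form \<open>l\<close>. That it annihilates \<open>F\<close> means
  \<open>\<alpha>\<^sup>2 q = 2 \<alpha> (\<beta> q - \<alpha>\<^sup>2 l)\<close>. The left side is even in \<open>y\<close> and the right side is odd, so both vanish,
  and \<open>q = 0\<close>, \<open>l = 0\<close> (\<open>defect_zero\<close>). Now \<open>q = 0\<close> says that the symmetric connection \<open>\<Gamma>\<close> is metric,
  so it is the Levi-Civita connection (\<open>conn_eq_levi_civita\<close>) and the two curvatures agree
  (\<open>chern_curv_eq_riemann_curv\<close>). And \<open>l = 0\<close> says that \<open>\<beta>\<close> is parallel, so by the Ricci identity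
  \<open>\<beta>(R(u, w)z) = 0\<close> (\<open>form_annihilates_curvature\<close>).

  It remains to compute at a unit vector \<open>y\<close>. The fundamental tensor \<open>g\<^sub>y\<close> is explicit
  (\<open>fund_tensor_unit\<close>). The vector \<open>R(u, y)y\<close> is \<open>g\<close>-orthogonal to \<open>y\<close> and annihilated by \<open>\<beta>\<close>, and on such
  vectors \<open>g\<^sub>y\<close> is the multiple \<open>F\<^sup>2 (2 - F)\<close> of \<open>g\<close>. So the numerator of the flag curvature is
  \<open>F\<^sup>2 (2 - F)\<close> times that of the sectional curvature, while the Gram determinant of \<open>y, v\<close> with respect
  to \<open>g\<^sub>y\<close> is \<open>F\<^sup>4 (2 F\<^sup>2 \<beta>(v)\<^sup>2 + 2 - F)\<close> (\<open>flag_ratio\<close>).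
\<close>

section \<open>Differential calculus\<close>

text \<open>The derivative in a fixed direction as an operator on functions, so that iterated derivatives
  can be written and the operators for two directions can be commuted.\<close>

definition dird :: "'a::real_normed_vector \<Rightarrow> ('a \<Rightarrow> 'b::real_normed_vector) \<Rightarrow> 'a \<Rightarrow> 'b" where
  "dird w f x = frechet_derivative f (at x) w"

lemma smooth_on_imp_differentiable: "smooth_on f S \<Longrightarrow> x \<in> S \<Longrightarrow> f differentiable at x"
  unfolding smooth_on_def by (metis Ck_on.simps(2))

lemma has_derivative_dird: "f differentiable at x \<Longrightarrow> (f has_derivative (\<lambda>w. dird w f x)) (at x)"
  unfolding dird_def by (simp add: frechet_derivative_works[symmetric] eta_contract_eq)

lemma dird_eq: "(f has_derivative f') (at x) \<Longrightarrow> dird w f x = f' w"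
  unfolding dird_def by (simp add: frechet_derivative_at[symmetric])

lemma linear_dird: "f differentiable at x \<Longrightarrow> linear (\<lambda>w. dird w f x)"
  using has_derivative_dird has_derivative_linear by blast

lemma dird_cong:
  assumes "open S" "x \<in> S" "\<And>z. z \<in> S \<Longrightarrow> f z = g z"
  shows "dird w f x = dird w g x"
proof -
  have "(f has_derivative f') (at x) \<longleftrightarrow> (g has_derivative f') (at x)" for f'
    using has_derivative_transform_within_open[of _ f' x UNIV S] assms by metis
  then show ?thesis by (simp add: dird_def frechet_derivative_def)
qed

lemma smooth_on_dird: "smooth_on f S \<Longrightarrow> smooth_on (dird w f) S"
  unfolding smooth_on_def dird_def by (metis Ck_on.simps(2))

lemma Ck_on_Suc_dird: "Ck_on (Suc k) f S \<longleftrightarrow> (\<forall>x\<in>S. f differentiable at x) \<and> (\<forall>w. Ck_on k (dird w f) S)"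
  by (simp add: dird_def[abs_def])

lemma Ck_on_cong:
  assumes "open S"
  shows "(\<And>z. z \<in> S \<Longrightarrow> f z = g z) \<Longrightarrow> Ck_on k f S \<Longrightarrow> Ck_on k g S"
proof (induction k arbitrary: f g)
  case 0
  then show ?case by (metis Ck_on.simps(1) continuous_on_cong)
next
  case (Suc k)
  have "g differentiable at x" if "x \<in> S" for x
    using Suc.prems that has_derivative_transform_within_open[OF _ assms that, of f]
    unfolding Ck_on_Suc_dird differentiable_def by metis
  moreover have "Ck_on k (dird w g) S" for w
  proof (rule Suc.IH)
    show "Ck_on k (dird w f) S" using Suc.prems(2) unfolding Ck_on_Suc_dird by blast
    show "dird w f z = dird w g z" if "z \<in> S" for z
      by (rule dird_cong[OF assms that]) (rule Suc.prems)
  qed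
  ultimately show ?case by (simp del: Ck_on.simps add: Ck_on_Suc_dird)
qed

lemma Ck_on_Suc_imp: "Ck_on (Suc k) f S \<Longrightarrow> Ck_on k f S"
proof (induction k arbitrary: f)
  case 0
  then show ?case
    by (simp add: continuous_at_imp_continuous_on differentiable_imp_continuous_within)
next
  case (Suc k)
  then show ?case by (simp del: Ck_on.simps add: Ck_on_Suc_dird)
qed

lemma Ck_on_const: "Ck_on k (\<lambda>x. a) S"
  by (induction k arbitrary: a) auto

lemma Ck_on_add:
  assumes "open S"
  shows "Ck_on k f S \<Longrightarrow> Ck_on k h S \<Longrightarrow> Ck_on k (\<lambda>x. f x + h x) S"
proof (induction k arbitrary: f h)
  case 0
  then show ?case by (auto intro: continuous_on_add)
next
  case (Suc k)
  have d: "dird w (\<lambda>x. f x + h x) x = dird w f x + dird w h x" if "x \<in> S" for x w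
    using Suc.prems that
    by (intro dird_eq) (auto simp del: Ck_on.simps simp: Ck_on_Suc_dird intro!: has_derivative_add has_derivative_dird)
  have "Ck_on k (\<lambda>x. dird w f x + dird w h x) S" for w
    using Suc.prems unfolding Ck_on_Suc_dird by (intro Suc.IH) blast+
  then have "Ck_on k (dird w (\<lambda>x. f x + h x)) S" for w
    by (rule Ck_on_cong[OF assms, rotated]) (simp add: d)
  moreover have "(\<lambda>x. f x + h x) differentiable at x" if "x \<in> S" for x
    using Suc.prems that unfolding Ck_on_Suc_dird by (intro differentiable_add) blast+
  ultimately show ?case unfolding Ck_on_Suc_dird by blast
qed

lemma Ck_on_mult:
  fixes f h :: "'a::real_normed_vector \<Rightarrow> real"
  assumes "open S"
  shows "Ck_on k f S \<Longrightarrow> Ck_on k h S \<Longrightarrow> Ck_on k (\<lambda>x. f x * h x) S"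
proof (induction k arbitrary: f h)
  case 0
  then show ?case by (auto intro: continuous_on_mult)
next
  case (Suc k)
  have d: "dird w (\<lambda>x. f x * h x) x = f x * dird w h x + dird w f x * h x" if "x \<in> S" for x w
    using Suc.prems that
    by (intro dird_eq) (auto simp del: Ck_on.simps simp: Ck_on_Suc_dird intro!: has_derivative_mult has_derivative_dird)
  have "Ck_on k (\<lambda>x. f x * dird w h x + dird w f x * h x) S" for w
    using Suc.prems[unfolded Ck_on_Suc_dird] Suc.prems[THEN Ck_on_Suc_imp]
    by (intro Ck_on_add assms Suc.IH) blast+
  then have "Ck_on k (dird w (\<lambda>x. f x * h x)) S" for w
    by (rule Ck_on_cong[OF assms, rotated]) (simp add: d)
  moreover have "(\<lambda>x. f x * h x) differentiable at x" if "x \<in> S" for x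
    using Suc.prems that by (auto simp del: Ck_on.simps simp: Ck_on_Suc_dird)
  ultimately show ?case by (simp del: Ck_on.simps add: Ck_on_Suc_dird)
qed

lemma Ck_on_bounded_linear:
  assumes "open S" "bounded_linear L"
  shows "Ck_on k f S \<Longrightarrow> Ck_on k (\<lambda>x. L (f x)) S"
proof (induction k arbitrary: f)
  case 0
  then show ?case using assms by (auto intro: bounded_linear.continuous_on)
next
  case (Suc k)
  have hd: "((\<lambda>x. L (f x)) has_derivative (\<lambda>w. L (dird w f x))) (at x)" if "x \<in> S" for x
    using Suc.prems[unfolded Ck_on_Suc_dird] that
    by (blast intro: bounded_linear.has_derivative[OF assms(2) has_derivative_dird])
  have "Ck_on k (\<lambda>x. L (dird w f x)) S" for w
    using Suc.prems unfolding Ck_on_Suc_dird by (intro Suc.IH) blast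
  then have "Ck_on k (dird w (\<lambda>x. L (f x))) S" for w
    by (rule Ck_on_cong[OF assms(1), rotated]) (simp add: dird_eq[OF hd])
  then show ?case
    unfolding Ck_on_Suc_dird using hd[THEN differentiableI] by blast
qed

lemma smooth_on_const: "smooth_on (\<lambda>x. a) S"
  by (simp add: smooth_on_def Ck_on_const)

lemma smooth_on_mult:
  fixes f h :: "'a::real_normed_vector \<Rightarrow> real"
  shows "open S \<Longrightarrow> smooth_on f S \<Longrightarrow> smooth_on h S \<Longrightarrow> smooth_on (\<lambda>x. f x * h x) S"
  unfolding smooth_on_def using Ck_on_mult by blast

lemma smooth_on_sum:
  assumes "open S" "\<And>i. i \<in> I \<Longrightarrow> smooth_on (f i) S"
  shows "smooth_on (\<lambda>x. \<Sum>i\<in>I. f i x) S"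
proof -
  have "Ck_on k (\<lambda>x. \<Sum>i\<in>I. f i x) S" for k
    using assms
    by (induction I rule: infinite_finite_induct)
       (auto simp: smooth_on_def Ck_on_const intro!: Ck_on_add)
  then show ?thesis by (simp add: smooth_on_def)
qed

lemma smooth_on_vec_nth: "open S \<Longrightarrow> smooth_on f S \<Longrightarrow> smooth_on (\<lambda>x. f x $ i) S"
  unfolding smooth_on_def using Ck_on_bounded_linear[OF _ bounded_linear_vec_nth] by blast

lemma differentiable_has_real_derivative_line:
  fixes f :: "'a::real_normed_vector \<Rightarrow> real"
  assumes "f differentiable at (x + t *\<^sub>R u)"
  shows "((\<lambda>s. f (x + s *\<^sub>R u)) has_real_derivative dird u f (x + t *\<^sub>R u)) (at t)"
proof -
  have "((\<lambda>s. x + s *\<^sub>R u) has_derivative (\<lambda>s. s *\<^sub>R u)) (at t)"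
    by (auto intro!: derivative_eq_intros)
  from has_derivative_compose[OF this has_derivative_dird[OF assms]]
  have "((\<lambda>s. f (x + s *\<^sub>R u)) has_derivative (\<lambda>s. dird (s *\<^sub>R u) f (x + t *\<^sub>R u))) (at t)" .
  moreover have "(\<lambda>s. dird (s *\<^sub>R u) f (x + t *\<^sub>R u)) = (*) (dird u f (x + t *\<^sub>R u))"
    by (simp add: fun_eq_iff linear_cmul[OF linear_dird[OF assms]])
  ultimately show ?thesis by (simp add: has_field_derivative_def)
qed

lemma deriv_line:
  fixes f :: "'a::real_normed_vector \<Rightarrow> real"
  assumes "f differentiable at x"
  shows "deriv (\<lambda>s. f (x + s *\<^sub>R u)) 0 = dird u f x"
  using differentiable_has_real_derivative_line[of f x 0 u] assms by (simp add: DERIV_imp_deriv)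

text \<open>The mean value theorem, applied in direction \<open>u\<close> to the increment in direction \<open>v\<close> and then in
  direction \<open>v\<close> to the derivative in direction \<open>u\<close>. The left side is symmetric in \<open>u\<close> and \<open>v\<close>, so the
  same second difference also equals a mixed derivative taken in the other order.\<close>

lemma second_difference_mean_value:
  fixes f :: "'a::real_normed_vector \<Rightarrow> real"
  assumes f: "smooth_on f S" and h: "0 < h"
    and S: "\<And>s t. 0 \<le> s \<Longrightarrow> s \<le> h \<Longrightarrow> 0 \<le> t \<Longrightarrow> t \<le> h \<Longrightarrow> x + s *\<^sub>R u + t *\<^sub>R v \<in> S"
  obtains s t where "0 \<le> s" "s \<le> h" "0 \<le> t" "t \<le> h"
    "f (x + h *\<^sub>R u + h *\<^sub>R v) - f (x + h *\<^sub>R u) - f (x + h *\<^sub>R v) + f x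
       = h * h * dird v (dird u f) (x + s *\<^sub>R u + t *\<^sub>R v)"
proof -
  define \<phi> where "\<phi> s = f (x + s *\<^sub>R u + h *\<^sub>R v) - f (x + s *\<^sub>R u)" for s
  have *: "(\<phi> has_real_derivative dird u f (x + s *\<^sub>R u + h *\<^sub>R v) - dird u f (x + s *\<^sub>R u)) (at s)"
    if "0 \<le> s" "s \<le> h" for s
  proof -
    have "f differentiable at ((x + h *\<^sub>R v) + s *\<^sub>R u)" "f differentiable at (x + s *\<^sub>R u)"
      using S[of s h] S[of s 0] that h by (auto intro!: smooth_on_imp_differentiable[OF f] simp: algebra_simps)
    from DERIV_diff[OF this[THEN differentiable_has_real_derivative_line]]
    show ?thesis unfolding \<phi>_def by (simp add: algebra_simps)
  qed
  obtain s where s: "0 < s" "s < h"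
    "\<phi> h - \<phi> 0 = (h - 0) * (dird u f (x + s *\<^sub>R u + h *\<^sub>R v) - dird u f (x + s *\<^sub>R u))"
    using MVT2[OF h *] by blast
  define \<psi> where "\<psi> t = dird u f (x + s *\<^sub>R u + t *\<^sub>R v)" for t
  have "(\<psi> has_real_derivative dird v (dird u f) (x + s *\<^sub>R u + t *\<^sub>R v)) (at t)"
    if "0 \<le> t" "t \<le> h" for t
    unfolding \<psi>_def using S[of s t] s that
    by (intro differentiable_has_real_derivative_line smooth_on_imp_differentiable[OF smooth_on_dird[OF f]]) auto
  from MVT2[OF h this]
  obtain t where t: "0 < t" "t < h" "\<psi> h - \<psi> 0 = (h - 0) * dird v (dird u f) (x + s *\<^sub>R u + t *\<^sub>R v)"
    by blast
  show thesis
    by (rule that[of s t]) (use s t in \<open>auto simp: \<phi>_def \<psi>_def algebra_simps\<close>)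
qed

text \<open>Clairaut's theorem: for small \<open>h\<close> both mixed derivatives, at points close to \<open>x\<close>, equal the same second
  difference divided by \<open>h\<^sup>2\<close>, and both are continuous at \<open>x\<close>.\<close>

lemma dird_commute:
  fixes f :: "'a::real_normed_vector \<Rightarrow> real"
  assumes f: "smooth_on f S" and "open S" "x \<in> S"
  shows "dird u (dird v f) x = dird v (dird u f) x"
proof -
  define a where "a = dird v (dird u f)"
  define b where "b = dird u (dird v f)"
  have "\<bar>b x - a x\<bar> \<le> e" if e: "e > 0" for e
  proof -
    have "continuous (at x) a" "continuous (at x) b"
      unfolding a_def b_def using smooth_on_imp_differentiable f smooth_on_dird assms(3) 
      by (metis differentiable_imp_continuous_within)+
    then have "\<forall>\<^sub>F z in nhds x. dist (a z) (a x) < e/2" "\<forall>\<^sub>F z in nhds x. dist (b z) (b x) < e/2"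
      using e tendstoD[of a "a x" "nhds x" "e/2"] tendstoD[of b "b x" "nhds x" "e/2"] 
      by (auto simp: continuous_at isCont_def tendsto_at_iff_tendsto_nhds)
    moreover have "\<forall>\<^sub>F z in nhds x. z \<in> S" using assms eventually_nhds by blast
    ultimately have "\<forall>\<^sub>F z in nhds x. dist (a z) (a x) < e/2 \<and> dist (b z) (b x) < e/2 \<and> z \<in> S"
      by (auto intro: eventually_conj)
    then obtain d where d: "d > 0"
      "\<And>z. dist z x < d \<Longrightarrow> dist (a z) (a x) < e/2 \<and> dist (b z) (b x) < e/2 \<and> z \<in> S"
      unfolding eventually_nhds_metric by blast
    \<comment> \<open>This choice keeps the parallelogram spanned by \<open>h u\<close> and \<open>h v\<close> inside the ball of radius \<open>d\<close>.\<close>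
    define h where "h = d / (2 * (norm u + norm v + 1))"
    have n: "norm u + norm v + 1 > 0" by (smt (verit) norm_ge_zero)
    have h: "h > 0" using d n by (simp add: h_def)
    have hd: "h * (norm u + norm v) < d"
    proof -
      have "h * (norm u + norm v) \<le> h * (norm u + norm v + 1)" using h by simp
      also have "\<dots> = d / 2" using n by (simp add: h_def field_simps)
      finally show ?thesis using d by simp
    qed
    have near: "dist (x + s *\<^sub>R u + t *\<^sub>R v) x < d" if "0 \<le> s" "s \<le> h" "0 \<le> t" "t \<le> h" for s t
    proof -
      have "dist (x + s *\<^sub>R u + t *\<^sub>R v) x = norm (s *\<^sub>R u + t *\<^sub>R v)"
        by (simp add: dist_norm add.assoc)
      also have "\<dots> \<le> s * norm u + t * norm v"
        using that norm_triangle_ineq[of "s *\<^sub>R u" "t *\<^sub>R v"] by simp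
      also have "\<dots> \<le> h * norm u + h * norm v" using that by (intro add_mono mult_right_mono) auto
      finally show ?thesis using hd by (simp add: algebra_simps)
    qed
    obtain s t where st: "0 \<le> s" "s \<le> h" "0 \<le> t" "t \<le> h"
      "f (x + h *\<^sub>R u + h *\<^sub>R v) - f (x + h *\<^sub>R u) - f (x + h *\<^sub>R v) + f x
         = h * h * a (x + s *\<^sub>R u + t *\<^sub>R v)"
      using second_difference_mean_value[OF f h, of x u v] near d(2) unfolding a_def by metis
    obtain s' t' where st': "0 \<le> s'" "s' \<le> h" "0 \<le> t'" "t' \<le> h"
      "f (x + h *\<^sub>R v + h *\<^sub>R u) - f (x + h *\<^sub>R v) - f (x + h *\<^sub>R u) + f x
         = h * h * b (x + s' *\<^sub>R v + t' *\<^sub>R u)"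
    proof (rule second_difference_mean_value[OF f h, of x v u])
      show "x + s *\<^sub>R v + t *\<^sub>R u \<in> S" if "0 \<le> s" "s \<le> h" "0 \<le> t" "t \<le> h" for s t
        using near[of t s] d(2) that by (simp add: algebra_simps)
    qed (auto simp: b_def)
    have "h * h * a (x + s *\<^sub>R u + t *\<^sub>R v) = h * h * b (x + s' *\<^sub>R v + t' *\<^sub>R u)"
      using st(5) st'(5) by (simp add: algebra_simps)
    then have "a (x + s *\<^sub>R u + t *\<^sub>R v) = b (x + t' *\<^sub>R u + s' *\<^sub>R v)"
      using h by (simp add: algebra_simps)
    moreover have "dist (a (x + s *\<^sub>R u + t *\<^sub>R v)) (a x) < e/2"
      "dist (b (x + t' *\<^sub>R u + s' *\<^sub>R v)) (b x) < e/2"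
      using near d(2) st st' by blast+
    ultimately show ?thesis by (simp add: dist_real_def) argo
  qed
  then have "\<bar>b x - a x\<bar> \<le> 0" by (rule field_le_epsilon[of _ 0, simplified]) 
  then show ?thesis by (simp add: a_def b_def)
qed

lemma differentiable_prod:
  fixes f :: "'i \<Rightarrow> 'a::real_normed_vector \<Rightarrow> real"
  assumes "\<And>i. i \<in> I \<Longrightarrow> f i differentiable at x"
  shows "(\<lambda>z. \<Prod>i\<in>I. f i z) differentiable at x"
  using has_derivative_prod[of I f "\<lambda>i w. dird w (f i) x" x UNIV] assms has_derivative_dird
  unfolding differentiable_def by blast

lemma differentiable_det:
  fixes M :: "'a::real_normed_vector \<Rightarrow> real^'n^'n"
  assumes "\<And>i j. (\<lambda>z. M z $ i $ j) differentiable at x"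
  shows "(\<lambda>z. det (M z)) differentiable at x"
proof -
  have "(\<lambda>z. \<Prod>i\<in>UNIV. M z $ i $ p i) differentiable at x" for p
    by (rule differentiable_prod) (rule assms)
  then have "(\<lambda>z. of_int (sign p) * (\<Prod>i\<in>UNIV. M z $ i $ p i)) differentiable at x" for p
    by (rule differentiable_mult[OF differentiable_const])
  then show ?thesis
    unfolding det_def by (intro differentiable_sum) auto
qed

lemma matrix_inv_inverse:
  assumes "invertible A"
  shows "A ** matrix_inv A = mat 1" "matrix_inv A ** A = mat 1"
  using someI_ex[OF assms[unfolded invertible_def]] by (auto simp: matrix_inv_def)

text \<open>Cramer's rule exhibits the entries of the inverse as rational functions of the entries, which is
  all that is needed for their differentiability.\<close>

lemma matrix_inv_cramer:
  fixes B :: "real^'n^'n"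
  assumes "det B \<noteq> 0"
  shows "matrix_inv B $ k $ j = det (\<chi> i l. if l = k then axis j 1 $ i else B $ i $ l) / det B"
proof -
  have "B ** matrix_inv B = mat 1"
    using assms invertible_det_nz matrix_inv_inverse(1) by blast
  then have "B *v column j (matrix_inv B) = axis j 1"
    by (metis matrix_vector_mul_assoc matrix_vector_mul_lid matrix_vector_mult_basis)
  then have "column j (matrix_inv B) = (\<chi> k. det (\<chi> i l. if l = k then axis j 1 $ i else B $ i $ l) / det B)"
    using cramer[OF assms] by blast
  then show ?thesis by (simp add: column_def vec_eq_iff)
qed

lemma differentiable_matrix_inv:
  fixes M :: "'a::real_normed_vector \<Rightarrow> real^'n^'n"
  assumes M: "\<And>i j. (\<lambda>z. M z $ i $ j) differentiable at x" and "det (M x) \<noteq> 0"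
  shows "(\<lambda>z. matrix_inv (M z) $ k $ l) differentiable at x"
proof -
  have dM: "(\<lambda>z. det (M z)) differentiable at x" by (rule differentiable_det[OF M])
  then have "isCont (\<lambda>z. det (M z)) x"
    using differentiable_imp_continuous_within by blast
  then have ev: "\<forall>\<^sub>F z in at x. det (M z) \<noteq> 0"
    using assms(2) tendsto_imp_eventually_ne by (fastforce simp: isCont_def)
  have "(\<lambda>z. det (\<chi> i j. if j = k then axis l 1 $ i else M z $ i $ j) / det (M z)) differentiable at x"
  proof (rule differentiable_divide[OF differentiable_det dM assms(2)])
    show "(\<lambda>z. (\<chi> i j. if j = k then axis l 1 $ i else M z $ i $ j) $ i $ j) differentiable at x" for i j
      using M by (cases "j = k") auto
  qed
  then obtain D where "((\<lambda>z. det (\<chi> i j. if j = k then axis l 1 $ i else M z $ i $ j) / det (M z))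
      has_derivative D) (at x)" unfolding differentiable_def by blast
  then have "((\<lambda>z. matrix_inv (M z) $ k $ l) has_derivative D) (at x)"
    by (rule has_derivative_transform_eventually)
       (use ev assms(2) in \<open>auto simp: matrix_inv_cramer elim!: eventually_mono\<close>)
  then show ?thesis by (rule differentiableI)
qed

section \<open>Coordinate derivatives and linear algebra\<close>

text \<open>Partial derivatives of functions of a base point \<open>x\<close> and a tangent vector \<open>y\<close>.\<close>

abbreviation dx :: "'n::finite \<Rightarrow> ((real^'n) \<times> (real^'n) \<Rightarrow> real) \<Rightarrow> (real^'n) \<times> (real^'n) \<Rightarrow> real" where
  "dx k \<equiv> dird (axis k 1, 0)"

abbreviation dy :: "'n::finite \<Rightarrow> ((real^'n) \<times> (real^'n) \<Rightarrow> real) \<Rightarrow> (real^'n) \<times> (real^'n) \<Rightarrow> real" where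
  "dy k \<equiv> dird (0, axis k 1)"

lemma partial_eq_dird: "f differentiable at x \<Longrightarrow> partial k f x = dird (axis k 1) f x"
  unfolding partial_def by (rule deriv_line)

lemma partial_fst:
  assumes "f differentiable at (x, y)"
  shows "partial k (\<lambda>x'. f (x', y)) x = dx k f (x, y)"
  using deriv_line[OF assms, of "(axis k 1, 0)"] by (simp add: partial_def)

lemma partial_snd:
  assumes "f differentiable at (x, y)"
  shows "partial k (\<lambda>y'. f (x, y')) y = dy k f (x, y)"
  using deriv_line[OF assms, of "(0, axis k 1)"] by (simp add: partial_def)

lemma eventually_line_in:
  fixes x :: "'a::real_normed_vector"
  assumes "open V" "x \<in> V"
  shows "\<forall>\<^sub>F t in nhds (0::real). x + t *\<^sub>R u \<in> V"
proof -
  have "open ((\<lambda>t. x + t *\<^sub>R u) -` V)"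
    using assms(1) by (intro open_vimage continuous_intros) 
  then show ?thesis
    using assms(2) by (subst eventually_nhds) (intro exI[of _ "(\<lambda>t. x + t *\<^sub>R u) -` V"], auto)
qed

lemma partial_cong:
  assumes "open V" "x \<in> V" "\<And>z. z \<in> V \<Longrightarrow> f z = h z"
  shows "partial k f x = partial k h x"
  unfolding partial_def
  by (rule deriv_cong_ev) (use eventually_line_in[OF assms(1,2), of "axis k 1"] assms(3) in \<open>auto elim: eventually_mono\<close>)

lemma dird_snd_expand:
  fixes f :: "(real^'n) \<times> (real^'n) \<Rightarrow> real"
  assumes "f differentiable at z"
  shows "dird (0, b) f z = (\<Sum>j\<in>UNIV. b $ j * dy j f z)"
proof -
  have "(0::real^'n, b) = (\<Sum>j\<in>UNIV. b $ j *\<^sub>R (0, axis j 1))"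
    by (simp add: prod_eq_iff fst_sum snd_sum basis_expansion[of b, unfolded scalar_mult_eq_scaleR])
  then show ?thesis
    by (simp only: linear_sum[OF linear_dird[OF assms]] linear_cmul[OF linear_dird[OF assms]] real_scaleR_def)
qed

lemma invertible_posdef:
  fixes B :: "real^'n^'n"
  assumes "\<And>w. w \<noteq> 0 \<Longrightarrow> w \<bullet> (B *v w) > 0"
  shows "invertible B"
  unfolding invertible_left_inverse matrix_left_invertible_ker using assms by fastforce

text \<open>Indices lowered with a matrix cancel against those raised with its inverse. Spray, Chern and
  Levi-Civita coefficients are all defined with an inverse matrix; this removes it from identities
  before they are differentiated.\<close>

lemma matrix_mult_inv_entries:
  fixes B :: "real^'n^'n"
  assumes "invertible B"
  shows "(\<Sum>i\<in>UNIV. B $ s $ i * (\<Sum>r\<in>UNIV. matrix_inv B $ i $ r * q r)) = q s"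
proof -
  have "B *v (matrix_inv B *v (\<chi> r. q r)) = (\<chi> r. q r)"
    by (simp add: matrix_vector_mul_assoc matrix_inv_inverse[OF assms])
  then have "(B *v (matrix_inv B *v (\<chi> r. q r))) $ s = q s" by simp
  then show ?thesis by (simp add: matrix_vector_mult_def)
qed

lemma invertible_cancel_entries:
  fixes B :: "real^'n^'n"
  assumes "invertible B" "\<And>s. (\<Sum>i\<in>UNIV. B $ s $ i * p i) = (\<Sum>i\<in>UNIV. B $ s $ i * q i)"
  shows "p i = q i"
proof -
  have "B *v (\<chi> i. p i) = B *v (\<chi> i. q i)"
    using assms(2) by (simp add: vec_eq_iff matrix_vector_mult_def)
  then have "matrix_inv B *v (B *v (\<chi> i. p i)) = matrix_inv B *v (B *v (\<chi> i. q i))" by simp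
  then have "(\<chi> i. p i) = (\<chi> i. q i)"
    by (simp add: matrix_vector_mul_assoc matrix_inv_inverse[OF assms(1)])
  then show ?thesis by (simp add: vec_eq_iff)
qed

section \<open>Finsler functions in coordinates\<close>

text \<open>All identities of this locale come from differentiating the energy \<open>F\<^sup>2\<close>, a smooth function on the slit
  tangent bundle of a chart. Of the inverse of the fundamental matrix only the differentiability is
  used, never its derivative.\<close>

locale local_finsler =
  fixes L :: "real^'n \<Rightarrow> real^'n \<Rightarrow> real" and U :: "(real^'n) set"
  assumes open_U: "open U"
    and smooth_L: "smooth_on (\<lambda>(x, y). L x y) (U \<times> (UNIV - {0}))"
    and homog: "x \<in> U \<Longrightarrow> 0 < r \<Longrightarrow> L x (r *\<^sub>R y) = r * L x y"
    and posdef: "x \<in> U \<Longrightarrow> y \<noteq> 0 \<Longrightarrow> w \<noteq> 0 \<Longrightarrow> w \<bullet> (fund_matrix L x y *v w) > 0"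
begin

definition slit :: "((real^'n) \<times> (real^'n)) set" where "slit = U \<times> (UNIV - {0})"

definition energy :: "(real^'n) \<times> (real^'n) \<Rightarrow> real" where "energy z = (L (fst z) (snd z))\<^sup>2"

lemma mem_slit [simp]: "(x, y) \<in> slit \<longleftrightarrow> x \<in> U \<and> y \<noteq> 0" by (simp add: slit_def)

lemma open_slit: "open slit"
  unfolding slit_def using open_U by (intro open_Times open_delete) auto

lemma smooth_energy: "smooth_on energy slit"
proof -
  have "smooth_on (\<lambda>z. (case z of (x, y) \<Rightarrow> L x y) * (case z of (x, y) \<Rightarrow> L x y)) slit"
    using smooth_L open_slit by (intro smooth_on_mult) (simp_all add: slit_def)
  then show ?thesis by (simp add: energy_def[abs_def] power2_eq_square split_beta)
qed

lemmas smooth = smooth_energy smooth_on_dird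

lemma differentiable_on_slit: "smooth_on f slit \<Longrightarrow> z \<in> slit \<Longrightarrow> f differentiable at z"
  by (rule smooth_on_imp_differentiable)

lemma dird_swap: "smooth_on f slit \<Longrightarrow> z \<in> slit \<Longrightarrow> dird u (dird v f) z = dird v (dird u f) z"
  for f :: "(real^'n) \<times> (real^'n) \<Rightarrow> real"
  using dird_commute open_slit by blast

lemma dird_swap_inner:
  fixes f :: "(real^'n) \<times> (real^'n) \<Rightarrow> real"
  assumes "smooth_on f slit" "z \<in> slit"
  shows "dird w (dird u (dird v f)) z = dird w (dird v (dird u f)) z"
  using assms open_slit dird_swap by (intro dird_cong[of slit]) auto

text \<open>Homogeneity of degree \<open>d\<close> in \<open>y\<close>, in the infinitesimal form of Euler's identity: this form passes to
  partial derivatives by differentiating the identity.\<close>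

definition homogeneous :: "real \<Rightarrow> ((real^'n) \<times> (real^'n) \<Rightarrow> real) \<Rightarrow> bool" where
  "homogeneous d f \<longleftrightarrow> smooth_on f slit \<and> (\<forall>x y. (x, y) \<in> slit \<longrightarrow> (\<Sum>j\<in>UNIV. y $ j * dy j f (x, y)) = d * f (x, y))"

lemma homogeneousD:
  "homogeneous d f \<Longrightarrow> (x, y) \<in> slit \<Longrightarrow> (\<Sum>j\<in>UNIV. y $ j * dy j f (x, y)) = d * f (x, y)"
  by (auto simp: homogeneous_def)

lemma homogeneous_energy: "homogeneous 2 energy"
  unfolding homogeneous_def
proof (intro conjI allI impI smooth_energy)
  fix x y assume z: "(x, y) \<in> slit"
  have "((\<lambda>s. energy ((x, y) + s *\<^sub>R (0, y))) has_real_derivative dird (0, y) energy ((x, y) + 0 *\<^sub>R (0, y))) (at 0)"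
    by (rule differentiable_has_real_derivative_line) (use z differentiable_on_slit[OF smooth_energy] in auto)
  \<comment> \<open>The energy on the ray through \<open>y\<close> is \<open>(1 + s)\<^sup>2\<close> times its value at \<open>y\<close>.\<close>
  then have h1: "((\<lambda>s. energy ((x, y) + s *\<^sub>R (0, y))) has_real_derivative dird (0, y) energy (x, y)) (at 0)"
    by simp
  have h2: "((\<lambda>s. (1 + s)\<^sup>2 * energy (x, y)) has_real_derivative 2 * energy (x, y)) (at 0)"
    by (auto intro!: derivative_eq_intros)
  have ev: "\<forall>\<^sub>F s in nhds (0::real). energy ((x, y) + s *\<^sub>R (0, y)) = (1 + s)\<^sup>2 * energy (x, y)"
  proof -
    have "\<forall>\<^sub>F s in nhds (0::real). s > -1"
      by (rule eventually_nhds_in_open[of "{-1<..}", simplified]) auto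
    then show ?thesis
    proof eventually_elim
      case (elim s)
      have "L x (y + s *\<^sub>R y) = (1 + s) * L x y"
        using homog[of x "1 + s" y] z elim by (simp add: algebra_simps)
      then show ?case by (simp add: energy_def power_mult_distrib)
    qed
  qed
  have "dird (0, y) energy (x, y) = 2 * energy (x, y)"
    by (rule DERIV_unique[OF h1 iffD2[OF DERIV_cong_ev[OF refl ev refl] h2]])
  then show "(\<Sum>j\<in>UNIV. y $ j * dy j energy (x, y)) = 2 * energy (x, y)"
    using dird_snd_expand[OF differentiable_on_slit[OF smooth_energy z], of y] by simp
qed

text \<open>Euler's identity, differentiated in the direction \<open>(a, b)\<close>; the extra term \<open>dird (0, b) f\<close> comes from
  differentiating the factor \<open>y\<^sup>j\<close>.\<close>

lemma homogeneous_dird: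
  assumes f: "homogeneous d f" and "(x, y) \<in> slit"
  shows "(\<Sum>j\<in>UNIV. y $ j * dy j (dird (a, b) f) (x, y)) = d * dird (a, b) f (x, y) - dird (0, b) f (x, y)"
proof -
  have sf: "smooth_on f slit" using f by (simp add: homogeneous_def)
  have c: "((\<lambda>z. snd z $ j) has_derivative (\<lambda>w. snd w $ j)) (at z)" for j and z :: "(real^'n) \<times> (real^'n)"
    by (intro bounded_linear.has_derivative[OF bounded_linear_vec_nth] has_derivative_snd has_derivative_ident)
  have "((\<lambda>z. \<Sum>j\<in>UNIV. snd z $ j * dy j f z) has_derivative
     (\<lambda>w. \<Sum>j\<in>UNIV. y $ j * dird w (dy j f) (x, y) + snd w $ j * dy j f (x, y))) (at (x, y))"
  proof (rule has_derivative_sum)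
    fix j :: 'n
    show "((\<lambda>z. snd z $ j * dy j f z) has_derivative
        (\<lambda>w. y $ j * dird w (dy j f) (x, y) + snd w $ j * dy j f (x, y))) (at (x, y))"
      using has_derivative_mult[OF c[of j] has_derivative_dird[OF differentiable_on_slit[OF smooth_on_dird[OF sf] assms(2)]]] by simp
  qed
  from dird_eq[OF this, of "(a, b)"]
  have "dird (a, b) (\<lambda>z. \<Sum>j\<in>UNIV. snd z $ j * dy j f z) (x, y)
    = (\<Sum>j\<in>UNIV. y $ j * dird (a, b) (dy j f) (x, y)) + dird (0, b) f (x, y)"
    by (simp add: sum.distrib dird_snd_expand[OF differentiable_on_slit[OF sf assms(2)], of b])
  also have "(\<Sum>j\<in>UNIV. y $ j * dird (a, b) (dy j f) (x, y)) = (\<Sum>j\<in>UNIV. y $ j * dy j (dird (a, b) f) (x, y))"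
    by (simp add: dird_swap[OF sf assms(2), of "(a, b)"])
  finally have "dird (a, b) (\<lambda>z. \<Sum>j\<in>UNIV. snd z $ j * dy j f z) (x, y)
     = (\<Sum>j\<in>UNIV. y $ j * dy j (dird (a, b) f) (x, y)) + dird (0, b) f (x, y)" .
  moreover have "dird (a, b) (\<lambda>z. \<Sum>j\<in>UNIV. snd z $ j * dy j f z) (x, y) = dird (a, b) (\<lambda>z. d * f z) (x, y)"
    using open_slit assms(2) homogeneousD[OF f] by (intro dird_cong[of slit]) auto
  moreover have "dird (a, b) (\<lambda>z. d * f z) (x, y) = d * dird (a, b) f (x, y)"
    by (rule dird_eq) (intro has_derivative_mult_right has_derivative_dird differentiable_on_slit[OF sf assms(2)])
  ultimately show ?thesis by simp
qed

lemma homogeneous_dx: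
  assumes "homogeneous d f" shows "homogeneous d (dx k f)"
proof -
  have sf: "smooth_on f slit" using assms by (simp add: homogeneous_def)
  have "dird (0, 0) f z = 0" if "z \<in> slit" for z
    using linear_0[OF linear_dird[OF differentiable_on_slit[OF sf that]]] by (simp add: zero_prod_def)
  then show ?thesis
    using homogeneous_dird[OF assms, of _ _ "axis k 1" 0] smooth_on_dird[OF sf]
    by (auto simp: homogeneous_def)
qed

lemma homogeneous_dy: "homogeneous d f \<Longrightarrow> homogeneous (d - 1) (dy k f)"
  using homogeneous_dird[of d f _ _ 0 "axis k 1"]
  unfolding homogeneous_def by (auto simp: smooth_on_dird algebra_simps)

lemma fund_tensor_eq:
  assumes "x \<in> U" "y \<noteq> 0"
  shows "fund_tensor (L x) y u v = 1/2 * dird (0, u) (dird (0, v) energy) (x, y)"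
proof -
  have "\<forall>\<^sub>F s in nhds (0::real). (x, y) + s *\<^sub>R (0, u) \<in> slit"
    using eventually_line_in[OF open_slit, of "(x, y)" "(0, u)"] assms by simp
  then have "\<forall>\<^sub>F s in nhds 0. deriv (\<lambda>t. (L x (y + s *\<^sub>R u + t *\<^sub>R v))\<^sup>2) 0 = dird (0, v) energy ((x, y) + s *\<^sub>R (0, u))"
  proof eventually_elim
    case (elim s)
    show ?case using deriv_line[OF differentiable_on_slit[OF smooth_energy elim], of "(0, v)"] by (simp add: energy_def)
  qed
  then have "deriv (\<lambda>s. deriv (\<lambda>t. (L x (y + s *\<^sub>R u + t *\<^sub>R v))\<^sup>2) 0) 0
      = deriv (\<lambda>s. dird (0, v) energy ((x, y) + s *\<^sub>R (0, u))) 0"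
    by (rule deriv_cong_ev) simp
  also have "\<dots> = dird (0, u) (dird (0, v) energy) (x, y)"
    using assms by (intro deriv_line differentiable_on_slit smooth) auto
  finally show ?thesis by (simp add: fund_tensor_def)
qed

lemma fund_matrix_eq:
  "(x, y) \<in> slit \<Longrightarrow> fund_matrix L x y $ i $ j = 1/2 * dy i (dy j energy) (x, y)"
  by (simp add: fund_matrix_def fund_tensor_eq)

lemma invertible_fund_matrix: "(x, y) \<in> slit \<Longrightarrow> invertible (fund_matrix L x y)"
  using posdef by (intro invertible_posdef) auto

lemma fund_matrix_radial:
  assumes "(x, y) \<in> slit"
  shows "(\<Sum>l\<in>UNIV. y $ l * fund_matrix L x y $ l $ m) = 1/2 * dy m energy (x, y)"
  using homogeneousD[OF homogeneous_dy[OF homogeneous_energy] assms, of m]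
  by (simp add: fund_matrix_eq[OF assms] sum_distrib_left[symmetric] mult.left_commute[of _ "1/2"]
      sum_divide_distrib[symmetric])

text \<open>Contracting the fundamental matrix twice with \<open>y\<close> gives back the energy, so positive definiteness
  makes the energy positive.\<close>

lemma energy_pos:
  assumes "(x, y) \<in> slit" shows "(L x y)\<^sup>2 > 0"
proof -
  have "y \<bullet> (fund_matrix L x y *v y) = (\<Sum>m\<in>UNIV. (\<Sum>l\<in>UNIV. y $ l * fund_matrix L x y $ l $ m) * y $ m)"
    by (simp add: inner_vec_def matrix_vector_mult_def sum_distrib_left sum_distrib_right mult.assoc)
       (rule sum.swap)
  also have "\<dots> = 1/2 * (\<Sum>m\<in>UNIV. y $ m * dy m energy (x, y))"
    by (simp add: fund_matrix_radial[OF assms] sum_distrib_left mult.commute mult.left_commute)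
  also have "\<dots> = energy (x, y)" using homogeneousD[OF homogeneous_energy assms] by simp
  finally show ?thesis using posdef[of x y y] assms by (simp add: energy_def)
qed

text \<open>The bracket in the definition of the geodesic coefficients, before the index is raised.\<close>

definition spray_rhs :: "'n \<Rightarrow> (real^'n) \<times> (real^'n) \<Rightarrow> real" where
  "spray_rhs l z = (\<Sum>k\<in>UNIV. dx k (dy l energy) z * snd z $ k) - dx l energy z"

lemma spray_eq:
  assumes "(x, y) \<in> slit"
  shows "spray L i x y = 1/4 * (\<Sum>l\<in>UNIV. matrix_inv (fund_matrix L x y) $ i $ l * spray_rhs l (x, y))"
proof -
  have x: "x \<in> U" and y: "y \<noteq> 0" using assms by auto
  have "partial k (\<lambda>x'. partial l (\<lambda>y'. (L x' y')\<^sup>2) y) x = dx k (dy l energy) (x, y)" for k l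
  proof -
    have "partial l (\<lambda>y'. (L x' y')\<^sup>2) y = dy l energy (x', y)" if "x' \<in> U" for x'
      using partial_snd[OF differentiable_on_slit[OF smooth_energy], of x' y l] that y by (simp add: energy_def)
    then have "partial k (\<lambda>x'. partial l (\<lambda>y'. (L x' y')\<^sup>2) y) x = partial k (\<lambda>x'. dy l energy (x', y)) x"
      by (intro partial_cong[OF open_U x])
    then show ?thesis using partial_fst[OF differentiable_on_slit[OF smooth_on_dird[OF smooth_energy] assms]] by simp
  qed
  moreover have "partial l (\<lambda>x'. (L x' y)\<^sup>2) x = dx l energy (x, y)" for l
    using partial_fst[OF differentiable_on_slit[OF smooth_energy assms]] by (simp add: energy_def)
  ultimately show ?thesis by (simp add: spray_def spray_rhs_def)
qed

lemma fund_matrix_spray: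
  assumes "(x, y) \<in> slit"
  shows "(\<Sum>m\<in>UNIV. fund_matrix L x y $ l $ m * spray L m x y) = 1/4 * spray_rhs l (x, y)"
  using matrix_mult_inv_entries[OF invertible_fund_matrix[OF assms], of l "\<lambda>l. 1/4 * spray_rhs l (x, y)"]
  by (simp add: spray_eq[OF assms] sum_distrib_left mult.left_commute)

lemma differentiable_on_slit_cong:
  fixes f h :: "(real^'n) \<times> (real^'n) \<Rightarrow> real"
  assumes "z \<in> slit" "\<And>z. z \<in> slit \<Longrightarrow> f z = h z" "f differentiable at z"
  shows "h differentiable at z"
  using assms has_derivative_transform_within_open[OF _ open_slit assms(1), of f]
  unfolding differentiable_def by metis

lemma has_derivative_spray_rhs:
  assumes "(x, y) \<in> slit"
  shows "(spray_rhs l has_derivative (\<lambda>w.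
    (\<Sum>k\<in>UNIV. dx k (dy l energy) (x, y) * snd w $ k + dird w (dx k (dy l energy)) (x, y) * y $ k) - dird w (dx l energy) (x, y))) (at (x, y))"
proof -
  have c: "((\<lambda>z. snd z $ j) has_derivative (\<lambda>w. snd w $ j)) (at z)" for j and z :: "(real^'n) \<times> (real^'n)"
    by (intro bounded_linear.has_derivative[OF bounded_linear_vec_nth] has_derivative_snd has_derivative_ident)
  have d: "dird u (dird v energy) differentiable at (x, y)" for u v
    by (rule differentiable_on_slit[OF _ assms]) (intro smooth)
  have d': "dird u energy differentiable at (x, y)" for u
    by (rule differentiable_on_slit[OF _ assms]) (intro smooth)
  have "((\<lambda>z. dx k (dy l energy) z * snd z $ k) has_derivative
      (\<lambda>w. dx k (dy l energy) (x, y) * snd w $ k + dird w (dx k (dy l energy)) (x, y) * y $ k)) (at (x, y))" for k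
    using has_derivative_mult[OF has_derivative_dird[OF d] c[of k]] by simp
  then show ?thesis unfolding spray_rhs_def[abs_def]
    by (rule has_derivative_diff[OF has_derivative_sum has_derivative_dird[OF d']])
qed

lemma differentiable_fund_matrix:
  assumes "(x, y) \<in> slit"
  shows "(\<lambda>z. fund_matrix L (fst z) (snd z) $ i $ j) differentiable at (x, y)"
proof (rule differentiable_on_slit_cong[OF assms, of "\<lambda>z. 1/2 * dy i (dy j energy) z"])
  show "1/2 * dy i (dy j energy) z = fund_matrix L (fst z) (snd z) $ i $ j" if "z \<in> slit" for z
    using fund_matrix_eq[of "fst z" "snd z"] that by simp
  show "(\<lambda>z. 1/2 * dy i (dy j energy) z) differentiable at (x, y)"
    by (rule differentiable_mult[OF differentiable_const differentiable_on_slit[OF _ assms]]) (intro smooth)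
qed

lemma dird_fund_matrix:
  assumes "(x, y) \<in> slit"
  shows "dird w (\<lambda>z. fund_matrix L (fst z) (snd z) $ i $ j) (x, y) = 1/2 * dird w (dy i (dy j energy)) (x, y)"
proof -
  have "dird w (\<lambda>z. fund_matrix L (fst z) (snd z) $ i $ j) (x, y) = dird w (\<lambda>z. 1/2 * dy i (dy j energy) z) (x, y)"
    by (rule dird_cong[OF open_slit assms]) (use fund_matrix_eq in auto)
  also have "\<dots> = 1/2 * dird w (dy i (dy j energy)) (x, y)"
    by (rule dird_eq, rule has_derivative_mult_right, rule has_derivative_dird)
       (rule differentiable_on_slit[OF _ assms], intro smooth)
  finally show ?thesis .
qed

lemma differentiable_spray:
  assumes "(x, y) \<in> slit"
  shows "(\<lambda>z. spray L i (fst z) (snd z)) differentiable at (x, y)"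
proof (rule differentiable_on_slit_cong[OF assms])
  show "1/4 * (\<Sum>l\<in>UNIV. matrix_inv (fund_matrix L (fst z) (snd z)) $ i $ l * spray_rhs l z)
      = spray L i (fst z) (snd z)" if "z \<in> slit" for z
    using spray_eq[of "fst z" "snd z"] that by simp
  have "(\<lambda>z. matrix_inv (fund_matrix L (fst z) (snd z)) $ i $ l) differentiable at (x, y)" for l
    using invertible_fund_matrix[OF assms]
    by (intro differentiable_matrix_inv differentiable_fund_matrix assms) (simp add: invertible_det_nz)
  moreover have "spray_rhs l differentiable at (x, y)" for l
    using has_derivative_spray_rhs[OF assms] differentiableI by blast
  ultimately show "(\<lambda>z. 1/4 * (\<Sum>l\<in>UNIV. matrix_inv (fund_matrix L (fst z) (snd z)) $ i $ l * spray_rhs l z))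
      differentiable at (x, y)"
    by (intro differentiable_mult differentiable_const differentiable_sum) auto
qed

lemma nonlin_conn_eq:
  "(x, y) \<in> slit \<Longrightarrow> nonlin_conn L i j x y = dy j (\<lambda>z. spray L i (fst z) (snd z)) (x, y)"
  unfolding nonlin_conn_def using partial_snd[OF differentiable_spray, of x y j i] by simp

text \<open>The identity \<open>4 g\<^sub>l\<^sub>m G\<^sup>m = y\<^sup>k \<partial>\<^sup>2F\<^sup>2/\<partial>x\<^sup>k\<partial>y\<^sup>l - \<partial>F\<^sup>2/\<partial>x\<^sup>l\<close> differentiated in \<open>y\<^sup>j\<close>. Its contractions with \<open>y\<^sup>l\<close> and
  with \<open>y\<^sup>j\<close> give the next two lemmas.\<close>

lemma fund_matrix_nonlin_conn:
  assumes "(x, y) \<in> slit"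
  shows "(\<Sum>m\<in>UNIV. fund_matrix L x y $ l $ m * nonlin_conn L m j x y)
    = 1/4 * ((\<Sum>k\<in>UNIV. dy j (dx k (dy l energy)) (x, y) * y $ k) + dx j (dy l energy) (x, y) - dy j (dx l energy) (x, y))
      - 1/2 * (\<Sum>m\<in>UNIV. dy j (dy l (dy m energy)) (x, y) * spray L m x y)"
proof -
  let ?w = "(0::real^'n, axis j 1::real^'n)"
  let ?M = "\<lambda>m z. fund_matrix L (fst z) (snd z) $ l $ m" and ?G = "\<lambda>m z. spray L m (fst z) (snd z)"
  have "((\<lambda>z. \<Sum>m\<in>UNIV. ?M m z * ?G m z) has_derivative
     (\<lambda>w. \<Sum>m\<in>UNIV. ?M m (x, y) * dird w (?G m) (x, y) + dird w (?M m) (x, y) * ?G m (x, y))) (at (x, y))"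
    by (intro has_derivative_sum has_derivative_mult has_derivative_dird differentiable_fund_matrix
          differentiable_spray assms)
  from dird_eq[OF this, of ?w]
  have "(\<Sum>m\<in>UNIV. fund_matrix L x y $ l $ m * nonlin_conn L m j x y)
       + 1/2 * (\<Sum>m\<in>UNIV. dy j (dy l (dy m energy)) (x, y) * spray L m x y)
     = dy j (\<lambda>z. \<Sum>m\<in>UNIV. ?M m z * ?G m z) (x, y)"
    by (simp add: sum.distrib nonlin_conn_eq[OF assms] dird_fund_matrix[OF assms] sum_divide_distrib)
  also have "\<dots> = dy j (\<lambda>z. 1/4 * spray_rhs l z) (x, y)"
    by (rule dird_cong[OF open_slit assms]) (use fund_matrix_spray in auto)
  also have "\<dots> = 1/4 * dy j (spray_rhs l) (x, y)"
    using has_derivative_spray_rhs[OF assms] differentiableI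
    by (intro dird_eq has_derivative_mult_right has_derivative_dird) blast
  also have "dy j (spray_rhs l) (x, y)
     = (\<Sum>k\<in>UNIV. dy j (dx k (dy l energy)) (x, y) * y $ k) + dx j (dy l energy) (x, y) - dy j (dx l energy) (x, y)"
    by (simp add: dird_eq[OF has_derivative_spray_rhs[OF assms]] sum.distrib axis_def
         if_distrib[of "\<lambda>t. _ * t"] cong: if_cong)
  finally show ?thesis unfolding eq_diff_eq .
qed

text \<open>The horizontal derivatives annihilate \<open>F\<^sup>2\<close>. Contracting the preceding identity with \<open>y\<^sup>l\<close> turns the
  left side into half of the vertical part of this derivative; by homogeneity the terms with third
  derivatives in \<open>y\<close> vanish and the first and third terms of the right side cancel.\<close>

lemma energy_horizontal:
  assumes z: "(x, y) \<in> slit"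
  shows "(\<Sum>m\<in>UNIV. nonlin_conn L m j x y * dy m energy (x, y)) = dx j energy (x, y)"
proof -
  have "(\<Sum>l\<in>UNIV. y $ l * (\<Sum>m\<in>UNIV. fund_matrix L x y $ l $ m * nonlin_conn L m j x y))
      = (\<Sum>m\<in>UNIV. (\<Sum>l\<in>UNIV. y $ l * fund_matrix L x y $ l $ m) * nonlin_conn L m j x y)"
    by (simp add: sum_distrib_left sum_distrib_right mult.assoc) (rule sum.swap)
  also have "\<dots> = 1/2 * (\<Sum>m\<in>UNIV. nonlin_conn L m j x y * dy m energy (x, y))"
    by (simp add: fund_matrix_radial[OF z] sum_divide_distrib mult.commute)
  finally have lhs: "(\<Sum>l\<in>UNIV. y $ l * (\<Sum>m\<in>UNIV. fund_matrix L x y $ l $ m * nonlin_conn L m j x y))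
      = 1/2 * (\<Sum>m\<in>UNIV. nonlin_conn L m j x y * dy m energy (x, y))" .
  have "(\<Sum>l\<in>UNIV. y $ l * (\<Sum>k\<in>UNIV. dy j (dx k (dy l energy)) (x, y) * y $ k))
      = (\<Sum>k\<in>UNIV. y $ k * (\<Sum>l\<in>UNIV. y $ l * dy l (dy j (dx k energy)) (x, y)))"
    unfolding dird_swap_inner[OF smooth_energy z, of "(0, axis j 1)" "(axis _ 1, 0)" "(0, axis _ 1)"]
      dird_swap[OF smooth_on_dird[OF smooth_energy] z, of "(0, axis j 1)" "(0, axis _ 1)"]
    by (simp add: sum_distrib_left mult_ac, subst sum.swap, simp add: mult_ac)
  also have "\<dots> = (\<Sum>k\<in>UNIV. y $ k * dy j (dx k energy) (x, y))"
    using homogeneousD[OF homogeneous_dy[OF homogeneous_dx[OF homogeneous_energy]] z] by simp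
  finally have a: "(\<Sum>l\<in>UNIV. y $ l * (\<Sum>k\<in>UNIV. dy j (dx k (dy l energy)) (x, y) * y $ k))
      = (\<Sum>k\<in>UNIV. y $ k * dy j (dx k energy) (x, y))" .
  have b: "(\<Sum>l\<in>UNIV. y $ l * dx j (dy l energy) (x, y)) = 2 * dx j energy (x, y)"
    unfolding dird_swap[OF smooth_energy z, of "(axis j 1, 0)"]
    by (rule homogeneousD[OF homogeneous_dx[OF homogeneous_energy] z])
  have "(\<Sum>l\<in>UNIV. y $ l * (\<Sum>m\<in>UNIV. dy j (dy l (dy m energy)) (x, y) * spray L m x y))
      = (\<Sum>m\<in>UNIV. (\<Sum>l\<in>UNIV. y $ l * dy l (dy j (dy m energy)) (x, y)) * spray L m x y)"
    unfolding dird_swap[OF smooth_on_dird[OF smooth_energy] z, of "(0, axis j 1)" "(0, axis _ 1)"]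
    by (simp add: sum_distrib_left sum_distrib_right mult.assoc) (rule sum.swap)
  also have "\<dots> = 0"
    using homogeneousD[OF homogeneous_dy[OF homogeneous_dy[OF homogeneous_energy]] z] by simp
  finally have d: "(\<Sum>l\<in>UNIV. y $ l * (\<Sum>m\<in>UNIV. dy j (dy l (dy m energy)) (x, y) * spray L m x y)) = 0" .
  show ?thesis
    using lhs a b d unfolding fund_matrix_nonlin_conn[OF z]
    by (simp add: algebra_simps sum.distrib sum_subtractf sum_distrib_left[symmetric] sum_divide_distrib[symmetric])
qed

text \<open>Euler's identity for the geodesic coefficients, which are homogeneous of degree 2. Contracting the
  differentiated identity with \<open>y\<^sup>j\<close> shows it after multiplication by the invertible fundamental matrix.\<close>

lemma nonlin_conn_radial:
  assumes z: "(x, y) \<in> slit"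
  shows "(\<Sum>j\<in>UNIV. y $ j * nonlin_conn L i j x y) = 2 * spray L i x y"
proof (rule invertible_cancel_entries[OF invertible_fund_matrix[OF z]])
  fix l
  have a: "(\<Sum>j\<in>UNIV. y $ j * (\<Sum>k\<in>UNIV. dy j (dx k (dy l energy)) (x, y) * y $ k))
      = (\<Sum>k\<in>UNIV. y $ k * dx k (dy l energy) (x, y))"
  proof -
    have "(\<Sum>j\<in>UNIV. y $ j * (\<Sum>k\<in>UNIV. dy j (dx k (dy l energy)) (x, y) * y $ k))
      = (\<Sum>k\<in>UNIV. y $ k * (\<Sum>j\<in>UNIV. y $ j * dy j (dx k (dy l energy)) (x, y)))"
      by (simp add: sum_distrib_left mult_ac, subst sum.swap, simp add: mult_ac)
    then show ?thesis
      using homogeneousD[OF homogeneous_dx[OF homogeneous_dy[OF homogeneous_energy]] z] by simp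
  qed
  have c: "(\<Sum>j\<in>UNIV. y $ j * dy j (dx l energy) (x, y)) = 2 * dx l energy (x, y)"
    by (rule homogeneousD[OF homogeneous_dx[OF homogeneous_energy] z])
  have d: "(\<Sum>j\<in>UNIV. y $ j * (\<Sum>m\<in>UNIV. dy j (dy l (dy m energy)) (x, y) * spray L m x y)) = 0"
  proof -
    have "(\<Sum>j\<in>UNIV. y $ j * (\<Sum>m\<in>UNIV. dy j (dy l (dy m energy)) (x, y) * spray L m x y))
      = (\<Sum>m\<in>UNIV. (\<Sum>j\<in>UNIV. y $ j * dy j (dy l (dy m energy)) (x, y)) * spray L m x y)"
      by (simp add: sum_distrib_left sum_distrib_right mult.assoc) (rule sum.swap)
    then show ?thesis
      using homogeneousD[OF homogeneous_dy[OF homogeneous_dy[OF homogeneous_energy]] z] by simp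
  qed
  have "(\<Sum>i\<in>UNIV. fund_matrix L x y $ l $ i * (\<Sum>j\<in>UNIV. y $ j * nonlin_conn L i j x y))
     = (\<Sum>j\<in>UNIV. y $ j * (\<Sum>i\<in>UNIV. fund_matrix L x y $ l $ i * nonlin_conn L i j x y))"
    by (simp add: sum_distrib_left mult_ac) (rule sum.swap)
  also have "\<dots> = 1/4 * ((\<Sum>j\<in>UNIV. y $ j * (\<Sum>k\<in>UNIV. dy j (dx k (dy l energy)) (x, y) * y $ k))
      + (\<Sum>j\<in>UNIV. y $ j * dx j (dy l energy) (x, y)) - (\<Sum>j\<in>UNIV. y $ j * dy j (dx l energy) (x, y)))
      - 1/2 * (\<Sum>j\<in>UNIV. y $ j * (\<Sum>m\<in>UNIV. dy j (dy l (dy m energy)) (x, y) * spray L m x y))"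
    unfolding fund_matrix_nonlin_conn[OF z] right_diff_distrib distrib_left sum_subtractf sum.distrib
      sum_distrib_left[symmetric] mult.left_commute[of "y $ _" "1/4"] mult.left_commute[of "y $ _" "1/2"] by simp
  also have "\<dots> = 1/2 * spray_rhs l (x, y)"
    unfolding a c d by (simp add: spray_rhs_def mult.commute)
  also have "\<dots> = (\<Sum>i\<in>UNIV. fund_matrix L x y $ l $ i * (2 * spray L i x y))"
    using fund_matrix_spray[OF z, of l] by (simp add: mult.left_commute sum_distrib_left[symmetric])
  finally show "(\<Sum>i\<in>UNIV. fund_matrix L x y $ l $ i * (\<Sum>j\<in>UNIV. y $ j * nonlin_conn L i j x y))
     = (\<Sum>i\<in>UNIV. fund_matrix L x y $ l $ i * (2 * spray L i x y))" .
qed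

lemma horiz_deriv_fund_matrix:
  assumes z: "(x, y) \<in> slit"
  shows "horiz_deriv L k (\<lambda>x y. fund_matrix L x y $ i $ j) x y
    = 1/2 * (dx k (dy i (dy j energy)) (x, y) - (\<Sum>m\<in>UNIV. nonlin_conn L m k x y * dy m (dy i (dy j energy)) (x, y)))"
proof -
  have p: "partial m (\<lambda>x'. fund_matrix L x' y $ i $ j) x = 1/2 * dx m (dy i (dy j energy)) (x, y)"
    and q: "partial m (\<lambda>y'. fund_matrix L x y' $ i $ j) y = 1/2 * dy m (dy i (dy j energy)) (x, y)" for m
    using partial_fst[OF differentiable_fund_matrix[OF z], of m i j]
      partial_snd[OF differentiable_fund_matrix[OF z], of m i j] dird_fund_matrix[OF z, of _ i j] by simp_all
  show ?thesis
    unfolding horiz_deriv_def p q by (simp add: diff_divide_distrib sum_divide_distrib)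
qed

lemma fund_matrix_chern:
  assumes z: "(x, y) \<in> slit"
  shows "(\<Sum>i\<in>UNIV. fund_matrix L x y $ s $ i * chern L i j k x y)
    = 1/2 * (horiz_deriv L k (\<lambda>x y. fund_matrix L x y $ s $ j) x y
      - horiz_deriv L s (\<lambda>x y. fund_matrix L x y $ j $ k) x y
      + horiz_deriv L j (\<lambda>x y. fund_matrix L x y $ k $ s) x y)"
  unfolding chern_def
  using matrix_mult_inv_entries[OF invertible_fund_matrix[OF z], of s
     "\<lambda>s. 1/2 * (horiz_deriv L k (\<lambda>x y. fund_matrix L x y $ s $ j) x y
      - horiz_deriv L s (\<lambda>x y. fund_matrix L x y $ j $ k) x y
      + horiz_deriv L j (\<lambda>x y. fund_matrix L x y $ k $ s) x y)"]
  unfolding mult.left_commute[of _ "1/2"] sum_distrib_left[symmetric] by (simp add: mult.left_commute)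

lemma horiz_deriv_fund_matrix_symmetric:
  assumes z: "(x, y) \<in> slit"
  shows "horiz_deriv L k (\<lambda>x y. fund_matrix L x y $ i $ j) x y = horiz_deriv L k (\<lambda>x y. fund_matrix L x y $ j $ i) x y"
  unfolding horiz_deriv_fund_matrix[OF z] dird_swap_inner[OF smooth_energy z, of _ "(0, axis i 1)" "(0, axis j 1)"] ..

lemma chern_symmetric:
  assumes z: "(x, y) \<in> slit"
  shows "chern L i j k x y = chern L i k j x y"
  using horiz_deriv_fund_matrix_symmetric[OF z] by (simp add: chern_def algebra_simps)

text \<open>Contracted with \<open>y\<^sup>j\<close>, the \<open>y\<close>-derivatives of \<open>g\<^sub>s\<^sub>j\<close> and \<open>g\<^sub>j\<^sub>k\<close> vanish by homogeneity, and those of \<open>g\<^sub>k\<^sub>s\<close>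
  meet \<open>N\<^sup>m\<^sub>j y\<^sup>j = 2 G\<^sup>m\<close>. What is left is the right side of \<open>fund_matrix_nonlin_conn\<close>.\<close>

lemma chern_radial:
  assumes z: "(x, y) \<in> slit"
  shows "(\<Sum>j\<in>UNIV. chern L i j k x y * y $ j) = nonlin_conn L i k x y"
proof (rule invertible_cancel_entries[OF invertible_fund_matrix[OF z],
      where p = "\<lambda>i. \<Sum>j\<in>UNIV. chern L i j k x y * y $ j" and q = "\<lambda>i. nonlin_conn L i k x y" and i = i])
  fix s
  have h1: "(\<Sum>j\<in>UNIV. y $ j * dx a (dy b (dy j energy)) (x, y)) = dx a (dy b energy) (x, y)" for a b
    unfolding dird_swap_inner[OF smooth_energy z, of _ "(0, axis b 1)" "(0, axis _ 1)"]
      dird_swap[OF smooth_on_dird[OF smooth_energy] z, of "(axis a 1, 0)" "(0, axis _ 1)"]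
    using homogeneousD[OF homogeneous_dx[OF homogeneous_dy[OF homogeneous_energy]] z] by simp
  have h0: "(\<Sum>j\<in>UNIV. y $ j * dy m (dy b (dy j energy)) (x, y)) = 0" for m b
    unfolding dird_swap_inner[OF smooth_energy z, of _ "(0, axis b 1)" "(0, axis _ 1)"]
      dird_swap[OF smooth_on_dird[OF smooth_energy] z, of "(0, axis m 1)" "(0, axis _ 1)"]
    using homogeneousD[OF homogeneous_dy[OF homogeneous_dy[OF homogeneous_energy]] z] by simp
  have n0: "(\<Sum>j\<in>UNIV. y $ j * (\<Sum>m\<in>UNIV. nonlin_conn L m a x y * dy m (dy b (dy j energy)) (x, y))) = 0" for a b
  proof -
    have "(\<Sum>j\<in>UNIV. y $ j * (\<Sum>m\<in>UNIV. nonlin_conn L m a x y * dy m (dy b (dy j energy)) (x, y)))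
      = (\<Sum>m\<in>UNIV. nonlin_conn L m a x y * (\<Sum>j\<in>UNIV. y $ j * dy m (dy b (dy j energy)) (x, y)))"
      by (simp add: sum_distrib_left mult_ac) (rule sum.swap)
    then show ?thesis by (simp add: h0)
  qed
  have t: "(\<Sum>j\<in>UNIV. y $ j * horiz_deriv L a (\<lambda>x y. fund_matrix L x y $ b $ j) x y) = 1/2 * dx a (dy b energy) (x, y)" for a b
    unfolding horiz_deriv_fund_matrix[OF z] right_diff_distrib mult.left_commute[of _ "1/2"]
      sum_subtractf sum_distrib_left[symmetric] h1 n0 by simp
  have cc: "dy m (dy k (dy s energy)) (x, y) = dy k (dy s (dy m energy)) (x, y)" for m
    by (metis dird_swap dird_swap_inner smooth_energy smooth_on_dird z)
  have "(\<Sum>j\<in>UNIV. y $ j * (\<Sum>m\<in>UNIV. nonlin_conn L m j x y * dy m (dy k (dy s energy)) (x, y)))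
      = (\<Sum>m\<in>UNIV. (\<Sum>j\<in>UNIV. y $ j * nonlin_conn L m j x y) * dy m (dy k (dy s energy)) (x, y))"
    by (simp add: sum_distrib_left sum_distrib_right mult.assoc) (rule sum.swap)
  also have "\<dots> = 2 * (\<Sum>m\<in>UNIV. dy k (dy s (dy m energy)) (x, y) * spray L m x y)"
    unfolding nonlin_conn_radial[OF z] cc by (simp add: sum_distrib_left mult_ac)
  finally have u: "(\<Sum>j\<in>UNIV. y $ j * horiz_deriv L j (\<lambda>x y. fund_matrix L x y $ k $ s) x y)
      = 1/2 * (\<Sum>j\<in>UNIV. y $ j * dx j (dy k (dy s energy)) (x, y))
        - (\<Sum>m\<in>UNIV. dy k (dy s (dy m energy)) (x, y) * spray L m x y)"
    unfolding horiz_deriv_fund_matrix[OF z] right_diff_distrib mult.left_commute[of _ "1/2"]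
      sum_subtractf sum_distrib_left[symmetric] by simp
  have "(\<Sum>i\<in>UNIV. fund_matrix L x y $ s $ i * (\<Sum>j\<in>UNIV. chern L i j k x y * y $ j))
     = (\<Sum>j\<in>UNIV. y $ j * (\<Sum>i\<in>UNIV. fund_matrix L x y $ s $ i * chern L i j k x y))"
    by (simp add: sum_distrib_left mult_ac) (rule sum.swap)
  also have "\<dots> = 1/2 * ((\<Sum>j\<in>UNIV. y $ j * horiz_deriv L k (\<lambda>x y. fund_matrix L x y $ s $ j) x y)
      - (\<Sum>j\<in>UNIV. y $ j * horiz_deriv L s (\<lambda>x y. fund_matrix L x y $ k $ j) x y)
      + (\<Sum>j\<in>UNIV. y $ j * horiz_deriv L j (\<lambda>x y. fund_matrix L x y $ k $ s) x y))"
    unfolding fund_matrix_chern[OF z] horiz_deriv_fund_matrix_symmetric[OF z, of s _ k]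
    by (simp add: algebra_simps sum.distrib sum_subtractf sum_divide_distrib add_divide_distrib diff_divide_distrib)
  also have "\<dots> = (\<Sum>i\<in>UNIV. fund_matrix L x y $ s $ i * nonlin_conn L i k x y)"
    unfolding t u fund_matrix_nonlin_conn[OF z]
      dird_swap[OF smooth_on_dird[OF smooth_energy] z, of "(0, axis k 1)" "(axis _ 1, 0)"]
      dird_swap[OF smooth_energy z, of "(0, axis k 1)" "(axis s 1, 0)"]
    by (simp add: mult.commute)
  finally show "(\<Sum>i\<in>UNIV. fund_matrix L x y $ s $ i * (\<Sum>j\<in>UNIV. chern L i j k x y * y $ j))
     = (\<Sum>i\<in>UNIV. fund_matrix L x y $ s $ i * nonlin_conn L i k x y)" .
qed

end

section \<open>The Levi-Civita connection in coordinates\<close>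

lemma partial_const [simp]: "partial k (\<lambda>x. a) x = 0"
  by (simp add: partial_def)

lemma dird_expand:
  fixes f :: "real^'n \<Rightarrow> real"
  assumes "f differentiable at x"
  shows "dird v f x = (\<Sum>k\<in>UNIV. v $ k * partial k f x)"
proof -
  have "dird (\<Sum>k\<in>UNIV. v $ k *\<^sub>R axis k 1) f x = (\<Sum>k\<in>UNIV. v $ k * partial k f x)"
    by (simp only: linear_sum[OF linear_dird[OF assms]] linear_cmul[OF linear_dird[OF assms]]
        real_scaleR_def partial_eq_dird[OF assms])
  then show ?thesis by (simp add: basis_expansion[of v, unfolded scalar_mult_eq_scaleR])
qed

lemma inner_transpose_mult:
  fixes B :: "real^'n^'n"
  shows "a \<bullet> (z v* B) = (B *v a) \<bullet> z"
  by (metis dot_lmul_matrix inner_commute)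

locale riemannian_chart =
  fixes h :: "real^'n \<Rightarrow> real^'n^'n" and U :: "(real^'n) set"
  assumes open_chart: "open U"
    and smooth_metric: "smooth_on (\<lambda>x. h x $ i $ j) U"
    and metric_sym: "x \<in> U \<Longrightarrow> h x $ i $ j = h x $ j $ i"
    and metric_pos: "x \<in> U \<Longrightarrow> w \<noteq> 0 \<Longrightarrow> w \<bullet> (h x *v w) > 0"
begin

definition ip :: "real^'n \<Rightarrow> real^'n \<Rightarrow> real^'n \<Rightarrow> real" where
  "ip x a b = a \<bullet> (h x *v b)"

text \<open>The matrix of the Christoffel part of the covariant derivative in the \<open>k\<close>-th coordinate direction.\<close>

definition christoffel :: "'n \<Rightarrow> real^'n \<Rightarrow> real^'n^'n" where
  "christoffel k x = (\<chi> i j. levi_civita h i j k x)"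

text \<open>The covariant derivative at \<open>x\<close>, in direction \<open>v\<close>, of the field with constant coefficients \<open>w\<close>.\<close>

definition nabla :: "real^'n \<Rightarrow> real^'n \<Rightarrow> real^'n \<Rightarrow> real^'n" where
  "nabla x v w = (\<Sum>k\<in>UNIV. v $ k *\<^sub>R (christoffel k x *v w))"

lemma ip_linear_left: "ip x (r *\<^sub>R a + s *\<^sub>R a') b = r * ip x a b + s * ip x a' b"
  by (simp add: ip_def inner_add_left)

lemma ip_linear_right: "ip x a (r *\<^sub>R b + s *\<^sub>R b') = r * ip x a b + s * ip x a b'"
  by (simp add: ip_def inner_add_right matrix_vector_right_distrib matrix_vector_mult_scaleR)

lemma ip_sum_left: "ip x (\<Sum>k\<in>I. r k *\<^sub>R a k) b = (\<Sum>k\<in>I. r k * ip x (a k) b)"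
  by (simp add: ip_def inner_sum_left)

lemma ip_sum_right: "ip x b (\<Sum>k\<in>I. r k *\<^sub>R a k) = (\<Sum>k\<in>I. r k * ip x b (a k))"
  by (simp add: ip_def inner_sum_right matrix_vector_mult_scaleR linear_sum[OF matrix_vector_mul_linear])

lemma ip_sym: "x \<in> U \<Longrightarrow> ip x a b = ip x b a"
proof -
  assume "x \<in> U"
  then have "transpose (h x) = h x" by (simp add: vec_eq_iff transpose_def metric_sym)
  then have "b v* h x = h x *v b" by (metis transpose_matrix_vector)
  then show ?thesis unfolding ip_def using inner_transpose_mult[of a b "h x"] by (simp add: inner_commute)
qed

lemma ip_expand: "ip x a b = (\<Sum>i\<in>UNIV. a $ i * (\<Sum>j\<in>UNIV. h x $ i $ j * b $ j))"
  by (simp add: ip_def inner_vec_def matrix_vector_mult_def)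

lemma nabla_linear: "nabla x v (r *\<^sub>R w + s *\<^sub>R w') = r *\<^sub>R nabla x v w + s *\<^sub>R nabla x v w'"
  by (simp add: nabla_def matrix_vector_right_distrib matrix_vector_mult_scaleR scaleR_sum_right
      sum.distrib scaleR_add_right mult.commute)

lemma nabla_linear_dir: "nabla x (r *\<^sub>R v + s *\<^sub>R v') w = r *\<^sub>R nabla x v w + s *\<^sub>R nabla x v' w"
  by (simp add: nabla_def scaleR_sum_right sum.distrib scaleR_add_left mult.commute)

lemma nabla_nth: "nabla x v w $ i = (\<Sum>k\<in>UNIV. v $ k * (\<Sum>j\<in>UNIV. levi_civita h i j k x * w $ j))"
  by (simp add: nabla_def christoffel_def matrix_vector_mult_def)

lemma differentiable_metric: "x \<in> U \<Longrightarrow> (\<lambda>x. h x $ i $ j) differentiable at x"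
  using smooth_on_imp_differentiable smooth_metric by blast

lemma invertible_metric: "x \<in> U \<Longrightarrow> invertible (h x)"
  using metric_pos by (intro invertible_posdef) auto

lemma differentiable_partial_metric:
  assumes "x \<in> U" shows "(\<lambda>x. partial k (\<lambda>x. h x $ i $ j) x) differentiable at x"
proof -
  obtain D where "(dird (axis k 1) (\<lambda>x. h x $ i $ j) has_derivative D) (at x)"
    using smooth_on_imp_differentiable[OF smooth_on_dird[OF smooth_metric] assms]
    unfolding differentiable_def by blast
  then have "((\<lambda>x. partial k (\<lambda>x. h x $ i $ j) x) has_derivative D) (at x)"
    by (rule has_derivative_transform_within_open[OF _ open_chart assms])
       (simp add: partial_eq_dird differentiable_metric)
  then show ?thesis by (rule differentiableI)
qed

lemma differentiable_levi_civita:
  assumes "x \<in> U" shows "levi_civita h i j k differentiable at x"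
proof -
  have "(\<lambda>x. matrix_inv (h x) $ i $ l) differentiable at x" for l
    using invertible_metric[OF assms]
    by (intro differentiable_matrix_inv differentiable_metric assms) (simp add: invertible_det_nz)
  then show ?thesis
    unfolding levi_civita_def[abs_def]
    by (intro differentiable_mult differentiable_const differentiable_sum differentiable_add ballI
        differentiable_diff differentiable_partial_metric assms finite)
qed

lemma partial_metric_sym:
  "x \<in> U \<Longrightarrow> partial k (\<lambda>x. h x $ i $ j) x = partial k (\<lambda>x. h x $ j $ i) x"
  by (rule partial_cong[OF open_chart]) (auto simp: metric_sym)

lemma metric_levi_civita:
  assumes "x \<in> U"
  shows "(\<Sum>m\<in>UNIV. h x $ s $ m * levi_civita h m j k x) = 1/2 *
     (partial k (\<lambda>x. h x $ s $ j) x - partial s (\<lambda>x. h x $ j $ k) x + partial j (\<lambda>x. h x $ k $ s) x)"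
  unfolding levi_civita_def
  using matrix_mult_inv_entries[OF invertible_metric[OF assms], of s "\<lambda>s. 1/2 *
     (partial k (\<lambda>x. h x $ s $ j) x - partial s (\<lambda>x. h x $ j $ k) x + partial j (\<lambda>x. h x $ k $ s) x)"]
  unfolding mult.left_commute[of _ "1/2"] sum_distrib_left[symmetric] by (simp add: mult.left_commute)

text \<open>Metric compatibility of the Levi-Civita connection, in matrix form.\<close>

lemma partial_metric:
  assumes "x \<in> U"
  shows "partial k (\<lambda>x. h x $ i $ j) x = (transpose (christoffel k x) ** h x + h x ** christoffel k x) $ i $ j"
proof -
  have "(transpose (christoffel k x) ** h x + h x ** christoffel k x) $ i $ j
     = (\<Sum>m\<in>UNIV. h x $ j $ m * levi_civita h m i k x) + (\<Sum>m\<in>UNIV. h x $ i $ m * levi_civita h m j k x)"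
    by (simp add: matrix_matrix_mult_def transpose_def christoffel_def metric_sym[OF assms, of _ j] mult.commute)
  also have "\<dots> = partial k (\<lambda>x. h x $ i $ j) x"
    unfolding metric_levi_civita[OF assms]
    using partial_metric_sym[OF assms, of k j i] partial_metric_sym[OF assms, of j k i]
      partial_metric_sym[OF assms, of i k j] by (simp add: field_simps)
  finally show ?thesis by simp
qed

lemma smooth_ip: "smooth_on (\<lambda>x. ip x a b) U"
  unfolding ip_expand
  by (intro smooth_on_sum smooth_on_mult smooth_on_const smooth_metric open_chart)

lemma differentiable_ip: "x \<in> U \<Longrightarrow> (\<lambda>x. ip x a b) differentiable at x"
  using smooth_ip smooth_on_imp_differentiable by blast

lemma dird_ip:
  assumes "x \<in> U"
  shows "dird v (\<lambda>x. ip x a b) x = ip x (nabla x v a) b + ip x a (nabla x v b)"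
proof -
  have "partial k (\<lambda>x. ip x a b) x = ip x (christoffel k x *v a) b + ip x a (christoffel k x *v b)" for k
  proof -
    have "((\<lambda>x. ip x a b) has_derivative (\<lambda>w. \<Sum>i\<in>UNIV. a $ i * (\<Sum>j\<in>UNIV. dird w (\<lambda>x. h x $ i $ j) x * b $ j))) (at x)"
      unfolding ip_expand
      by (intro has_derivative_sum has_derivative_mult_right has_derivative_mult_left
          has_derivative_dird differentiable_metric assms)
    then have "dird (axis k 1) (\<lambda>x. ip x a b) x
        = (\<Sum>i\<in>UNIV. a $ i * (\<Sum>j\<in>UNIV. partial k (\<lambda>x. h x $ i $ j) x * b $ j))"
      by (simp add: dird_eq partial_eq_dird[OF differentiable_metric[OF assms]])
    then have "partial k (\<lambda>x. ip x a b) x = a \<bullet> ((transpose (christoffel k x) ** h x + h x ** christoffel k x) *v b)"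
      by (simp add: partial_eq_dird[OF differentiable_ip[OF assms]] partial_metric[OF assms]
          inner_vec_def[of a] matrix_vector_mult_def)
    then show ?thesis
      by (simp add: matrix_vector_mult_add_rdistrib inner_add_right ip_def inner_transpose_mult
          flip: matrix_vector_mul_assoc)
  qed
  then show ?thesis
    by (simp add: dird_expand[OF differentiable_ip[OF assms]] nabla_def ip_sum_left ip_sum_right
        distrib_left sum.distrib)
qed

lemma differentiable_nabla: "x \<in> U \<Longrightarrow> (\<lambda>x. nabla x v w $ i) differentiable at x"
  unfolding nabla_nth
  by (intro differentiable_sum differentiable_mult differentiable_const differentiable_levi_civita ballI finite)

text \<open>The derivative of the field \<open>nabla x v w\<close> in direction \<open>u\<close>; with it the second covariant derivative
  \<open>\<nabla>\<^sub>u\<nabla>\<^sub>v w\<close> of constant coefficients splits into \<open>d_nabla x u v w + nabla x u (nabla x v w)\<close>.\<close>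

definition d_nabla :: "real^'n \<Rightarrow> real^'n \<Rightarrow> real^'n \<Rightarrow> real^'n \<Rightarrow> real^'n" where
  "d_nabla x u v w = (\<chi> i. dird u (\<lambda>x. nabla x v w $ i) x)"

lemma lc_deriv_const: "lc_deriv h v (\<lambda>_. w) x = nabla x v w"
  by (simp add: lc_deriv_def vec_eq_iff nabla_nth)

lemma lc_deriv_lc_deriv:
  assumes "x \<in> U"
  shows "lc_deriv h u (lc_deriv h v (\<lambda>_. w)) x = d_nabla x u v w + nabla x u (nabla x v w)"
  by (simp add: lc_deriv_def[of h u] lc_deriv_const[abs_def] vec_eq_iff d_nabla_def nabla_nth[of x u]
      dird_expand[OF differentiable_nabla[OF assms]] distrib_left sum.distrib)

lemma riemann_curv_eq:
  assumes "x \<in> U"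
  shows "riemann_curv h x u v w = d_nabla x u v w + nabla x u (nabla x v w) - (d_nabla x v u w + nabla x v (nabla x u w))"
  unfolding riemann_curv_def lc_deriv_lc_deriv[OF assms] ..

lemma dird_linear_combination:
  fixes f k :: "real^'n \<Rightarrow> real"
  assumes "f differentiable at x" "k differentiable at x"
  shows "dird u (\<lambda>x. r * f x + s * k x) x = r * dird u f x + s * dird u k x"
  using assms by (intro dird_eq has_derivative_add has_derivative_mult_right has_derivative_dird)

lemma d_nabla_linear:
  assumes "x \<in> U"
  shows "d_nabla x u v (r *\<^sub>R w + s *\<^sub>R w') = r *\<^sub>R d_nabla x u v w + s *\<^sub>R d_nabla x u v w'"
  using assms by (simp add: d_nabla_def vec_eq_iff nabla_linear dird_linear_combination differentiable_nabla)

lemma d_nabla_linear_mid: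
  assumes "x \<in> U"
  shows "d_nabla x u (r *\<^sub>R v + s *\<^sub>R v') w = r *\<^sub>R d_nabla x u v w + s *\<^sub>R d_nabla x u v' w"
  using assms by (simp add: d_nabla_def vec_eq_iff nabla_linear_dir dird_linear_combination differentiable_nabla)

lemma d_nabla_linear_dir:
  assumes "x \<in> U"
  shows "d_nabla x (r *\<^sub>R u + s *\<^sub>R u') v w = r *\<^sub>R d_nabla x u v w + s *\<^sub>R d_nabla x u' v w"
  by (simp add: d_nabla_def vec_eq_iff linear_add[OF linear_dird[OF differentiable_nabla[OF assms]]]
      linear_cmul[OF linear_dird[OF differentiable_nabla[OF assms]]])

lemma riemann_curv_linear:
  assumes "x \<in> U"
  shows "riemann_curv h x u v (r *\<^sub>R w + s *\<^sub>R w') = r *\<^sub>R riemann_curv h x u v w + s *\<^sub>R riemann_curv h x u v w'"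
  by (simp add: riemann_curv_eq[OF assms] d_nabla_linear[OF assms] nabla_linear algebra_simps)

lemma riemann_curv_swap: "riemann_curv h x v u w = - riemann_curv h x u v w"
  by (simp add: riemann_curv_def)

lemma riemann_curv_linear_dir:
  assumes "x \<in> U"
  shows "riemann_curv h x (r *\<^sub>R u + s *\<^sub>R u') v w = r *\<^sub>R riemann_curv h x u v w + s *\<^sub>R riemann_curv h x u' v w"
  by (simp add: riemann_curv_eq[OF assms] d_nabla_linear_mid[OF assms] d_nabla_linear_dir[OF assms]
      nabla_linear nabla_linear_dir algebra_simps)

lemma riemann_curv_change_basis:
  assumes "x \<in> U"
  shows "riemann_curv h x (a *\<^sub>R v + b *\<^sub>R y) (c *\<^sub>R v + d *\<^sub>R y) w = (a * d - b * c) *\<^sub>R riemann_curv h x v y w"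
proof -
  have *: "riemann_curv h x u (c *\<^sub>R v + d *\<^sub>R y) w = c *\<^sub>R riemann_curv h x u v w + d *\<^sub>R riemann_curv h x u y w" for u
  proof -
    have "riemann_curv h x u (c *\<^sub>R v + d *\<^sub>R y) w = - riemann_curv h x (c *\<^sub>R v + d *\<^sub>R y) u w"
      by (rule riemann_curv_swap)
    also have "\<dots> = - (c *\<^sub>R riemann_curv h x v u w + d *\<^sub>R riemann_curv h x y u w)"
      by (simp only: riemann_curv_linear_dir[OF assms])
    also have "\<dots> = c *\<^sub>R riemann_curv h x u v w + d *\<^sub>R riemann_curv h x u y w"
      using riemann_curv_swap[of x v u w] riemann_curv_swap[of x y u w] by simp
    finally show ?thesis .
  qed
  have "riemann_curv h x v v w = 0" "riemann_curv h x y y w = 0"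
    by (simp_all add: riemann_curv_def)
  then show ?thesis
    using riemann_curv_swap[of x y v w]
    by (simp add: riemann_curv_linear_dir[OF assms] * algebra_simps)
qed

text \<open>The product rule for a metric coefficient and the field \<open>nabla x v a\<close>. Expanding the field in the
  coordinate basis reduces it to products of scalar functions.\<close>

lemma dird_ip_nabla:
  assumes "x \<in> U"
  shows "dird u (\<lambda>x. ip x (nabla x v a) b) x = ip x (d_nabla x u v a + nabla x u (nabla x v a)) b + ip x (nabla x v a) (nabla x u b)"
proof -
  let ?f = "\<lambda>i x. ip x (axis i 1) b"
  have ex: "ip z c b = (\<Sum>i\<in>UNIV. c $ i * ?f i z)" for c z
    using ip_sum_left[of z "\<lambda>i. c $ i" "\<lambda>i. axis i 1" UNIV b]
    by (simp add: basis_expansion[of c, unfolded scalar_mult_eq_scaleR])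
  have "((\<lambda>x. \<Sum>i\<in>UNIV. nabla x v a $ i * ?f i x) has_derivative
     (\<lambda>u. \<Sum>i\<in>UNIV. nabla x v a $ i * dird u (?f i) x + dird u (\<lambda>x. nabla x v a $ i) x * ?f i x)) (at x)"
    using assms by (intro has_derivative_sum has_derivative_mult has_derivative_dird differentiable_nabla differentiable_ip)
  then have "dird u (\<lambda>x. ip x (nabla x v a) b) x =
     (\<Sum>i\<in>UNIV. nabla x v a $ i * dird u (?f i) x) + (\<Sum>i\<in>UNIV. d_nabla x u v a $ i * ?f i x)"
    by (subst ex) (simp add: dird_eq sum.distrib d_nabla_def)
  also have "(\<Sum>i\<in>UNIV. d_nabla x u v a $ i * ?f i x) = ip x (d_nabla x u v a) b"
    by (rule ex[symmetric])
  also have "(\<Sum>i\<in>UNIV. nabla x v a $ i * dird u (?f i) x) = dird u (\<lambda>z. ip z (nabla x v a) b) x"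
  proof -
    have "((\<lambda>z. \<Sum>i\<in>UNIV. nabla x v a $ i * ?f i z) has_derivative
       (\<lambda>u. \<Sum>i\<in>UNIV. nabla x v a $ i * dird u (?f i) x)) (at x)"
      using assms by (intro has_derivative_sum has_derivative_mult_right has_derivative_dird differentiable_ip)
    then show ?thesis by (subst (2) ex) (simp add: dird_eq)
  qed
  finally show ?thesis
    unfolding dird_ip[OF assms] by (simp add: ip_def inner_add_left)
qed

text \<open>The second derivative of \<open>ip a b\<close> in directions \<open>u\<close> and \<open>v\<close> is symmetric in \<open>u\<close>, \<open>v\<close>. By metric
  compatibility it is the sum of \<open>ip (\<nabla>\<^sub>u\<nabla>\<^sub>v a) b\<close>, of \<open>ip a (\<nabla>\<^sub>u\<nabla>\<^sub>v b)\<close> and of cross terms that are symmetric in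
  \<open>u\<close>, \<open>v\<close>, so antisymmetrising leaves the two curvature terms.\<close>

lemma riemann_curv_antisym:
  assumes "x \<in> U"
  shows "ip x (riemann_curv h x u v a) b = - ip x a (riemann_curv h x u v b)"
proof -
  have second: "dird u (dird v (\<lambda>x. ip x a b)) x
    = ip x (d_nabla x u v a + nabla x u (nabla x v a)) b + ip x (nabla x v a) (nabla x u b)
      + ip x (d_nabla x u v b + nabla x u (nabla x v b)) a + ip x (nabla x v b) (nabla x u a)" for u v
  proof -
    have "dird u (dird v (\<lambda>x. ip x a b)) x = dird u (\<lambda>x. 1 * ip x (nabla x v a) b + 1 * ip x (nabla x v b) a) x"
      using dird_ip ip_sym by (intro dird_cong[OF open_chart assms]) simp
    also have "\<dots> = dird u (\<lambda>x. ip x (nabla x v a) b) x + dird u (\<lambda>x. ip x (nabla x v b) a) x"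
    proof (subst dird_linear_combination)
      have "(\<lambda>x. ip x (nabla x v a) b) differentiable at x" for a b
        unfolding ip_expand
        by (intro differentiable_sum differentiable_mult differentiable_const differentiable_nabla
            differentiable_metric assms ballI finite)
      then show "(\<lambda>x. ip x (nabla x v a) b) differentiable at x" "(\<lambda>x. ip x (nabla x v b) a) differentiable at x" by auto
    qed auto
    finally show ?thesis by (simp add: dird_ip_nabla[OF assms])
  qed
  have "dird u (dird v (\<lambda>x. ip x a b)) x = dird v (dird u (\<lambda>x. ip x a b)) x"
    by (rule dird_commute[OF smooth_ip open_chart assms])
  then have "ip x (riemann_curv h x u v a) b + ip x (riemann_curv h x u v b) a = 0"
    unfolding second riemann_curv_eq[OF assms]
    using ip_sym[OF assms, of "nabla x v a" "nabla x u b"] ip_sym[OF assms, of "nabla x v b" "nabla x u a"]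
    by (simp add: ip_def inner_add_left inner_diff_left)
  then show ?thesis using ip_sym[OF assms, of a] by simp
qed

text \<open>The Ricci identity: \<open>b (\<nabla>\<^sub>u\<nabla>\<^sub>v w)\<close> is the second derivative of the function \<open>b \<bullet> w\<close> in directions \<open>u\<close> and
  \<open>v\<close> when \<open>b\<close> is parallel, hence symmetric in \<open>u\<close> and \<open>v\<close>.\<close>

lemma riemann_curv_parallel_covector:
  assumes x: "x \<in> U" and b: "\<And>j. smooth_on (\<lambda>x. b x $ j) U"
    and par: "\<And>x j k. x \<in> U \<Longrightarrow> partial k (\<lambda>x. b x $ j) x = (\<Sum>m\<in>UNIV. levi_civita h m j k x * b x $ m)"
  shows "b x \<bullet> riemann_curv h x u v w = 0"
proof -
  have db: "(\<lambda>x. b x $ j) differentiable at z" if "z \<in> U" for j z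
    using smooth_on_imp_differentiable[OF b that] .
  have dird_b: "(\<Sum>j\<in>UNIV. dird v (\<lambda>x. b x $ j) z * a $ j) = b z \<bullet> nabla z v a" if "z \<in> U" for v a z
  proof -
    have "(\<Sum>j\<in>UNIV. partial k (\<lambda>x. b x $ j) z * a $ j) = b z \<bullet> (christoffel k z *v a)" for k
      by (simp add: par[OF that] inner_vec_def matrix_vector_mult_def christoffel_def
          sum_distrib_left sum_distrib_right mult_ac) (rule sum.swap)
    then have "(\<Sum>k\<in>UNIV. v $ k * (\<Sum>j\<in>UNIV. partial k (\<lambda>x. b x $ j) z * a $ j)) = b z \<bullet> nabla z v a"
      by (simp add: nabla_def inner_sum_right)
    moreover have "(\<Sum>j\<in>UNIV. dird v (\<lambda>x. b x $ j) z * a $ j)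
        = (\<Sum>k\<in>UNIV. v $ k * (\<Sum>j\<in>UNIV. partial k (\<lambda>x. b x $ j) z * a $ j))"
      by (simp add: dird_expand[OF db[OF that]] sum_distrib_left sum_distrib_right mult.assoc) (rule sum.swap)
    ultimately show ?thesis by simp
  qed
  have sb: "smooth_on (\<lambda>x. b x \<bullet> w) U"
    unfolding inner_vec_def inner_real_def
    by (intro smooth_on_sum smooth_on_mult b smooth_on_const open_chart)
  have first: "dird v (\<lambda>x. b x \<bullet> w) z = b z \<bullet> nabla z v w" if "z \<in> U" for z v
  proof -
    have "((\<lambda>x. b x \<bullet> w) has_derivative (\<lambda>v. \<Sum>j\<in>UNIV. dird v (\<lambda>x. b x $ j) z * w $ j)) (at z)"
      unfolding inner_vec_def inner_real_def using that
      by (intro has_derivative_sum has_derivative_mult_left has_derivative_dird db)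
    then show ?thesis using dird_b[OF that] by (simp add: dird_eq)
  qed
  have second: "dird u (dird v (\<lambda>x. b x \<bullet> w)) x = b x \<bullet> (d_nabla x u v w + nabla x u (nabla x v w))" for u v
  proof -
    have "dird u (dird v (\<lambda>x. b x \<bullet> w)) x = dird u (\<lambda>x. b x \<bullet> nabla x v w) x"
      using first by (intro dird_cong[OF open_chart x])
    also have "((\<lambda>x. b x \<bullet> nabla x v w) has_derivative (\<lambda>u. \<Sum>j\<in>UNIV.
        b x $ j * dird u (\<lambda>x. nabla x v w $ j) x + dird u (\<lambda>x. b x $ j) x * nabla x v w $ j)) (at x)"
      unfolding inner_vec_def inner_real_def using x
      by (intro has_derivative_sum has_derivative_mult has_derivative_dird db differentiable_nabla)
    then have "dird u (\<lambda>x. b x \<bullet> nabla x v w) x = b x \<bullet> (d_nabla x u v w + nabla x u (nabla x v w))"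
      using dird_b[OF x, of u "nabla x v w"]
      by (simp add: dird_eq sum.distrib inner_add_right) (simp add: d_nabla_def inner_vec_def)
    finally show ?thesis .
  qed
  have "dird u (dird v (\<lambda>x. b x \<bullet> w)) x = dird v (dird u (\<lambda>x. b x \<bullet> w)) x"
    by (rule dird_commute[OF sb open_chart x])
  then show ?thesis
    unfolding second riemann_curv_eq[OF x] by (simp add: inner_diff_right)
qed

end

section \<open>Berwald type makes the metric and the form parallel\<close>

text \<open>With \<open>a = \<alpha>\<^sup>2\<close> and \<open>b = \<beta>\<close>: as \<open>F\<close> is positive, its derivative vanishes together with that of \<open>F\<^sup>2\<close>,
  and clearing denominators leaves a relation that is polynomial in \<open>\<alpha>\<close>, \<open>\<beta>\<close> and their derivatives.\<close>

lemma matsumoto_stationary: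
  fixes a b :: "real \<Rightarrow> real"
  assumes a: "(a has_real_derivative a') (at 0)" and b: "(b has_real_derivative b') (at 0)"
    and pos: "a 0 > 0" "sqrt (a 0) - b 0 > 0"
    and F: "((\<lambda>t. (a t / (sqrt (a t) - b t))\<^sup>2) has_real_derivative 0) (at 0)"
  shows "a 0 * a' = 2 * sqrt (a 0) * (b 0 * a' - a 0 * b')"
proof -
  let ?q = "sqrt (a 0)"
  have q: "?q * ?q = a 0" "?q > 0" using pos by auto
  have nz: "?q \<noteq> 0" "?q - b 0 \<noteq> 0" using q pos by auto
  have s: "((\<lambda>t. sqrt (a t)) has_real_derivative inverse ?q / 2 * a') (at 0)"
    by (rule DERIV_chain2[OF DERIV_real_sqrt[OF pos(1)] a])
  define D where "D = (a' * (?q - b 0) - a 0 * (inverse ?q / 2 * a' - b')) / ((?q - b 0) * (?q - b 0))"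
  have "((\<lambda>t. (a t / (sqrt (a t) - b t))\<^sup>2) has_real_derivative
      of_nat 2 * (D * (a 0 / (?q - b 0)) ^ (2 - Suc 0))) (at 0)"
    unfolding D_def
    by (intro DERIV_power DERIV_divide DERIV_diff a b s nz)
  from DERIV_unique[OF this F] have "D = 0" using pos nz by auto
  then have "a' * (?q - b 0) - a 0 * (inverse ?q / 2 * a' - b') = 0" using nz by (simp add: D_def)
  then have "2 * ?q * (a' * (?q - b 0) - a 0 * (inverse ?q / 2 * a' - b')) = 0" by simp
  moreover have "2 * ?q * (a' * (?q - b 0) - a 0 * (inverse ?q / 2 * a' - b'))
     = 2 * (?q * ?q) * a' - 2 * ?q * b 0 * a' - a 0 * a' * (?q * inverse ?q) + 2 * ?q * a 0 * b'"
    by (simp add: algebra_simps)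
  ultimately show ?thesis using nz unfolding q by (simp add: algebra_simps)
qed

text \<open>Polarisation.\<close>

lemma quadratic_form_zero:
  fixes Q :: "real^'n^'n"
  assumes "transpose Q = Q" "\<And>y. y \<bullet> (Q *v y) = 0"
  shows "Q = 0"
proof -
  have "axis i 1 \<bullet> (Q *v axis j 1) = 0" for i j
  proof -
    have "axis j 1 \<bullet> (Q *v axis i 1) = axis i 1 \<bullet> (Q *v axis j 1)"
      by (metis assms(1) dot_lmul_matrix inner_commute transpose_matrix_vector)
    then show ?thesis
      using assms(2)[of "axis i 1 + axis j 1"] assms(2)[of "axis i 1"] assms(2)[of "axis j 1"]
      by (simp add: inner_add_left inner_add_right matrix_vector_right_distrib)
  qed
  then show ?thesis
    by (simp add: vec_eq_iff inner_axis' matrix_vector_mult_basis column_def)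
qed

text \<open>The covector field \<open>b\<close> represents the form \<open>\<beta> = g(X, \<cdot>)\<close> in the coordinates of the chart.\<close>

locale matsumoto_berwald_chart = riemannian_chart h U + local_finsler L U
  for h :: "real^'n \<Rightarrow> real^'n^'n" and L :: "real^'n \<Rightarrow> real^'n \<Rightarrow> real" and U +
  fixes b :: "real^'n \<Rightarrow> real^'n"
  assumes smooth_form: "smooth_on (\<lambda>x. b x $ j) U"
    and matsumoto: "x \<in> U \<Longrightarrow> L x y = ip x y y / (sqrt (ip x y y) - b x \<bullet> y)"
    and nonneg: "x \<in> U \<Longrightarrow> L x y \<ge> 0"
    and berwald: "x \<in> U \<Longrightarrow> y \<noteq> 0 \<Longrightarrow> y' \<noteq> 0 \<Longrightarrow> chern L i j k x y = chern L i j k x y'"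
begin

lemma ip_pos: "x \<in> U \<Longrightarrow> y \<noteq> 0 \<Longrightarrow> ip x y y > 0"
  using metric_pos by (simp add: ip_def)

text \<open>A vanishing denominator would give \<open>L x y = 0\<close> and a negative one \<open>L x y < 0\<close>; the first contradicts
  positive definiteness of the fundamental tensor, the second nonnegativity.\<close>

lemma denominator_pos:
  assumes "x \<in> U" "y \<noteq> 0"
  shows "sqrt (ip x y y) - b x \<bullet> y > 0"
proof -
  have "(L x y)\<^sup>2 > 0" using energy_pos assms by simp
  then have "L x y > 0" using nonneg[OF assms(1), of y] by (simp add: order_less_le)
  then show ?thesis
    using ip_pos[OF assms] unfolding matsumoto[OF assms(1)] by (simp add: zero_less_divide_iff)
qed

text \<open>The common value of the Chern coefficients at all nonzero \<open>y\<close>; the basis vector merely serves as some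
  nonzero vector.\<close>

definition conn :: "'n \<Rightarrow> real^'n \<Rightarrow> real^'n^'n" where
  "conn k x = (\<chi> i j. chern L i j k x (axis undefined 1))"

lemma chern_eq_conn: "x \<in> U \<Longrightarrow> y \<noteq> 0 \<Longrightarrow> chern L i j k x y = conn k x $ i $ j"
  using berwald[of x y "axis undefined 1" i j k] by (simp add: conn_def axis_eq_0_iff)

lemma nonlin_conn_eq_conn: "x \<in> U \<Longrightarrow> y \<noteq> 0 \<Longrightarrow> nonlin_conn L i k x y = (conn k x *v y) $ i"
  using chern_radial[of x y i k] by (simp add: chern_eq_conn matrix_vector_mult_def)

lemma conn_symmetric: "x \<in> U \<Longrightarrow> conn k x $ i $ j = conn j x $ i $ k"
  using chern_symmetric[of x "axis undefined 1" i j k] by (simp add: conn_def axis_eq_0_iff)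

text \<open>The covariant derivatives of the metric and of the form with respect to \<open>conn\<close>, as a quadratic form
  and as a linear form in \<open>y\<close>: the obstructions to \<open>conn\<close> being metric and to the form being parallel.\<close>

definition defect_metric :: "'n \<Rightarrow> real^'n \<Rightarrow> real^'n^'n" where
  "defect_metric k x = (\<chi> i j. partial k (\<lambda>x. h x $ i $ j) x) - (transpose (conn k x) ** h x + h x ** conn k x)"

definition defect_form :: "'n \<Rightarrow> real^'n \<Rightarrow> real^'n" where
  "defect_form k x = (\<chi> j. partial k (\<lambda>x. b x $ j) x) - b x v* conn k x"

lemma line_derivative:
  fixes f :: "real^'n \<Rightarrow> real"
  assumes "f differentiable at x"
  shows "((\<lambda>t. f (x + t *\<^sub>R axis k 1)) has_real_derivative partial k f x) (at 0)"
  using differentiable_has_real_derivative_line[of f x 0 "axis k 1"] assms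
  by (simp add: partial_eq_dird[OF assms])

text \<open>To first order the curve \<open>t \<mapsto> (x + t e\<^sub>k, y - t \<Gamma>\<^sub>k y)\<close> transports \<open>y\<close> parallelly along the \<open>k\<close>-th
  coordinate line. The derivatives of \<open>\<alpha>\<^sup>2\<close>, \<open>\<beta>\<close> and \<open>F\<^sup>2\<close> along it are computed here and in the two
  transport lemmas below.\<close>

lemma metric_along_transport:
  assumes x: "x \<in> U"
  shows "((\<lambda>t. ip (x + t *\<^sub>R axis k 1) (y - t *\<^sub>R (conn k x *v y)) (y - t *\<^sub>R (conn k x *v y)))
     has_real_derivative y \<bullet> (defect_metric k x *v y)) (at 0)"
proof -
  let ?w = "conn k x *v y"
  have d: "((\<lambda>t. h (x + t *\<^sub>R axis k 1) $ i $ j) has_real_derivative partial k (\<lambda>x. h x $ i $ j) x) (at 0)" for i j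
    by (rule line_derivative[OF differentiable_metric[OF x]])
  have l: "((\<lambda>t. (y - t *\<^sub>R ?w) $ i) has_real_derivative - (?w $ i)) (at 0)" for i
    by (auto intro!: derivative_eq_intros)
  have "((\<lambda>t. \<Sum>i\<in>UNIV. (y - t *\<^sub>R ?w) $ i * (\<Sum>j\<in>UNIV. h (x + t *\<^sub>R axis k 1) $ i $ j * (y - t *\<^sub>R ?w) $ j))
     has_real_derivative (\<Sum>i\<in>UNIV. - (?w $ i) * (\<Sum>j\<in>UNIV. h (x + 0 *\<^sub>R axis k 1) $ i $ j * (y - 0 *\<^sub>R ?w) $ j)
       + (\<Sum>j\<in>UNIV. partial k (\<lambda>x. h x $ i $ j) x * (y - 0 *\<^sub>R ?w) $ j + - (?w $ j) * h (x + 0 *\<^sub>R axis k 1) $ i $ j)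
          * (y - 0 *\<^sub>R ?w) $ i)) (at 0)"
    by (intro DERIV_sum DERIV_mult d l)
  also have "(\<Sum>i\<in>UNIV. - (?w $ i) * (\<Sum>j\<in>UNIV. h (x + 0 *\<^sub>R axis k 1) $ i $ j * (y - 0 *\<^sub>R ?w) $ j)
       + (\<Sum>j\<in>UNIV. partial k (\<lambda>x. h x $ i $ j) x * (y - 0 *\<^sub>R ?w) $ j + - (?w $ j) * h (x + 0 *\<^sub>R axis k 1) $ i $ j)
          * (y - 0 *\<^sub>R ?w) $ i)
     = y \<bullet> ((\<chi> i j. partial k (\<lambda>x. h x $ i $ j) x) *v y) - ip x ?w y - ip x y ?w"
    unfolding ip_expand
    by (simp add: inner_vec_def[of y] matrix_vector_mult_def[of "\<chi> i j. partial k (\<lambda>x. h x $ i $ j) x"]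
        sum.distrib sum_subtractf sum_negf algebra_simps)
  also have "ip x ?w y = y \<bullet> ((transpose (conn k x) ** h x) *v y)"
    by (simp add: ip_def inner_transpose_mult flip: matrix_vector_mul_assoc)
  also have "ip x y ?w = y \<bullet> ((h x ** conn k x) *v y)"
    by (simp add: ip_def flip: matrix_vector_mul_assoc)
  finally show ?thesis
    unfolding ip_expand defect_metric_def
    by (simp add: matrix_vector_mult_diff_rdistrib matrix_vector_mult_add_rdistrib inner_diff_right inner_add_right algebra_simps)
qed

lemma differentiable_form: "x \<in> U \<Longrightarrow> (\<lambda>x. b x $ j) differentiable at x"
  using smooth_on_imp_differentiable[OF smooth_form] .

lemma form_along_transport:
  assumes x: "x \<in> U"
  shows "((\<lambda>t. b (x + t *\<^sub>R axis k 1) \<bullet> (y - t *\<^sub>R (conn k x *v y)))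
     has_real_derivative defect_form k x \<bullet> y) (at 0)"
proof -
  let ?w = "conn k x *v y"
  have d: "((\<lambda>t. b (x + t *\<^sub>R axis k 1) $ j) has_real_derivative partial k (\<lambda>x. b x $ j) x) (at 0)" for j
    by (rule line_derivative[OF differentiable_form[OF x]])
  have l: "((\<lambda>t. (y - t *\<^sub>R ?w) $ i) has_real_derivative - (?w $ i)) (at 0)" for i
    by (auto intro!: derivative_eq_intros)
  have "((\<lambda>t. \<Sum>j\<in>UNIV. b (x + t *\<^sub>R axis k 1) $ j * (y - t *\<^sub>R ?w) $ j) has_real_derivative
     (\<Sum>j\<in>UNIV. partial k (\<lambda>x. b x $ j) x * (y - 0 *\<^sub>R ?w) $ j + - (?w $ j) * b (x + 0 *\<^sub>R axis k 1) $ j)) (at 0)"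
    by (intro DERIV_sum DERIV_mult d l)
  also have "(\<Sum>j\<in>UNIV. partial k (\<lambda>x. b x $ j) x * (y - 0 *\<^sub>R ?w) $ j + - (?w $ j) * b (x + 0 *\<^sub>R axis k 1) $ j)
     = (\<chi> j. partial k (\<lambda>x. b x $ j) x) \<bullet> y - b x \<bullet> ?w"
    by (simp add: inner_vec_def sum.distrib sum_subtractf sum_negf algebra_simps)
  also have "b x \<bullet> ?w = (b x v* conn k x) \<bullet> y" by (simp add: dot_lmul_matrix)
  finally show ?thesis
    by (simp add: inner_vec_def[of "b _"] defect_form_def inner_diff_left)
qed

text \<open>The velocity of the curve is horizontal, since \<open>N\<^sup>i\<^sub>k = \<Gamma>\<^sup>i\<^sub>j\<^sub>k y\<^sup>j\<close>.\<close>

lemma energy_along_transport: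
  assumes x: "x \<in> U" and y: "y \<noteq> 0"
  shows "((\<lambda>t. energy (x + t *\<^sub>R axis k 1, y - t *\<^sub>R (conn k x *v y))) has_real_derivative 0) (at 0)"
proof -
  let ?w = "conn k x *v y"
  have z: "(x, y) \<in> slit" using x y by simp
  note dE = differentiable_on_slit[OF smooth_energy z]
  have "dird (axis k 1, - ?w) energy (x, y) = dx k energy (x, y) + dird (0, - ?w) energy (x, y)"
    using linear_add[OF linear_dird[OF dE], of "(axis k 1, 0)" "(0, - ?w)"] by simp
  also have "dird (0, - ?w) energy (x, y) = - dx k energy (x, y)"
    using energy_horizontal[OF z, of k]
    by (simp add: dird_snd_expand[OF dE, of "- ?w"] nonlin_conn_eq_conn[OF x y] sum_negf)
  finally show ?thesis
    using differentiable_has_real_derivative_line[of energy "(x, y)" 0 "(axis k 1, - ?w)"] dE by simp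
qed

lemma defect_relation:
  assumes x: "x \<in> U" and y: "y \<noteq> 0"
  shows "ip x y y * (y \<bullet> (defect_metric k x *v y)) = 2 * sqrt (ip x y y) *
     ((b x \<bullet> y) * (y \<bullet> (defect_metric k x *v y)) - ip x y y * (defect_form k x \<bullet> y))"
proof -
  let ?x = "\<lambda>t. x + t *\<^sub>R axis k 1" and ?y = "\<lambda>t. y - t *\<^sub>R (conn k x *v y)"
  have "\<forall>\<^sub>F t in nhds 0. ?x t \<in> U" by (rule eventually_line_in[OF open_U x])
  then have "\<forall>\<^sub>F t in nhds 0. energy (?x t, ?y t) = (ip (?x t) (?y t) (?y t) / (sqrt (ip (?x t) (?y t) (?y t)) - b (?x t) \<bullet> ?y t))\<^sup>2"
    by eventually_elim (simp add: energy_def matsumoto)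
  from DERIV_cong_ev[OF refl this refl] energy_along_transport[OF x y, of k]
  have "((\<lambda>t. (ip (?x t) (?y t) (?y t) / (sqrt (ip (?x t) (?y t) (?y t)) - b (?x t) \<bullet> ?y t))\<^sup>2) has_real_derivative 0) (at 0)"
    by blast
  from matsumoto_stationary[OF metric_along_transport[OF x] form_along_transport[OF x] _ _ this]
  show ?thesis using ip_pos[OF x y] denominator_pos[OF x y] by simp
qed

text \<open>The relation above holds for \<open>y\<close> and for \<open>- y\<close>. Its left side is even in \<open>y\<close> and its right side is odd,
  so both sides vanish.\<close>

lemma defect_zero:
  assumes x: "x \<in> U" and y: "y \<noteq> 0"
  shows "y \<bullet> (defect_metric k x *v y) = 0" "defect_form k x \<bullet> y = 0"
proof -
  let ?q = "y \<bullet> (defect_metric k x *v y)"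
  have neg: "- y \<noteq> 0" "ip x (- y) (- y) = ip x y y" "- y \<bullet> (defect_metric k x *v - y) = ?q"
    using y by (simp_all add: ip_def linear_neg[OF matrix_vector_mul_linear])
  note * = defect_relation[OF x y, of k]
  have "ip x y y * ?q = 2 * sqrt (ip x y y) * ((b x \<bullet> - y) * ?q - ip x y y * (defect_form k x \<bullet> - y))"
    using defect_relation[OF x neg(1), of k] unfolding neg .
  then have "ip x y y * ?q = - (2 * sqrt (ip x y y) * ((b x \<bullet> y) * ?q - ip x y y * (defect_form k x \<bullet> y)))"
    by (simp only: inner_minus_right) (simp only: algebra_simps)
  with * have "ip x y y * ?q = 0" by linarith
  then show q: "?q = 0" using ip_pos[OF x y] by simp
  show "defect_form k x \<bullet> y = 0" using * ip_pos[OF x y] by (simp add: q)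
qed

lemma partial_metric_conn:
  assumes "x \<in> U"
  shows "partial k (\<lambda>x. h x $ i $ j) x = (\<Sum>m\<in>UNIV. conn k x $ m $ i * h x $ m $ j) + (\<Sum>m\<in>UNIV. h x $ i $ m * conn k x $ m $ j)"
proof -
  have "defect_metric k x $ i $ j = defect_metric k x $ j $ i" for i j
    using partial_metric_sym[OF assms, of k i j]
    by (simp add: defect_metric_def matrix_matrix_mult_def transpose_def metric_sym[OF assms, of _ j]
        metric_sym[OF assms, of _ i] mult.commute)
  then have "transpose (defect_metric k x) = defect_metric k x" by (simp add: vec_eq_iff transpose_def)
  moreover have "y \<bullet> (defect_metric k x *v y) = 0" for y
    by (cases "y = 0") (simp_all add: defect_zero[OF assms])
  ultimately have "defect_metric k x $ i $ j = 0" using quadratic_form_zero[of "defect_metric k x"] by simp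
  then show ?thesis by (simp add: defect_metric_def matrix_matrix_mult_def transpose_def)
qed

lemma partial_form_conn:
  assumes "x \<in> U"
  shows "partial k (\<lambda>x. b x $ j) x = (\<Sum>m\<in>UNIV. conn k x $ m $ j * b x $ m)"
proof -
  have "defect_form k x \<bullet> axis j 1 = 0" by (rule defect_zero[OF assms]) (simp add: axis_eq_0_iff)
  then show ?thesis by (simp add: inner_axis defect_form_def vector_matrix_mult_def mult.commute)
qed

text \<open>Uniqueness of the torsion free metric connection.\<close>

lemma conn_eq_levi_civita:
  assumes "x \<in> U"
  shows "conn k x $ i $ j = levi_civita h i j k x"
proof (rule invertible_cancel_entries[OF invertible_metric[OF assms],
      where p = "\<lambda>i. conn k x $ i $ j" and q = "\<lambda>i. levi_civita h i j k x"])
  fix s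
  show "(\<Sum>i\<in>UNIV. h x $ s $ i * conn k x $ i $ j) = (\<Sum>i\<in>UNIV. h x $ s $ i * levi_civita h i j k x)"
    unfolding metric_levi_civita[OF assms] partial_metric_conn[OF assms]
    by (simp add: metric_sym[OF assms, of _ s] metric_sym[OF assms, of _ j] metric_sym[OF assms, of _ k]
        conn_symmetric[OF assms, of j _ k] conn_symmetric[OF assms, of s _ j] conn_symmetric[OF assms, of s _ k]
       mult.commute)
qed

lemma form_annihilates_curvature:
  assumes "x \<in> U"
  shows "b x \<bullet> riemann_curv h x u v w = 0"
  using partial_form_conn conn_eq_levi_civita
  by (intro riemann_curv_parallel_covector assms smooth_form) simp

lemma chern_deriv_const:
  assumes "x \<in> U" "y \<noteq> 0"
  shows "chern_deriv L v (\<lambda>_ _. w) x y = lc_deriv h v (\<lambda>_. w) x"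
  using assms
  by (simp add: chern_deriv_def lc_deriv_def horiz_deriv_def chern_eq_conn conn_eq_levi_civita)

text \<open>For a field that depends on the base point alone the vertical part of the horizontal derivative
  vanishes.\<close>

lemma chern_deriv_eq_lc_deriv:
  assumes x: "x \<in> U" and y: "y \<noteq> 0" and W: "\<And>x y. x \<in> U \<Longrightarrow> y \<noteq> 0 \<Longrightarrow> W x y = V x"
  shows "chern_deriv L u W x y = lc_deriv h u V x"
proof -
  have "partial k (\<lambda>x'. W x' y $ i) x = partial k (\<lambda>x. V x $ i) x" for k i
    using W y by (intro partial_cong[OF open_U x]) simp
  moreover have "partial m (\<lambda>y'. W x y' $ i) y = 0" for m i
    using partial_cong[of "UNIV - {0}" y "\<lambda>y'. W x y' $ i" "\<lambda>_. V x $ i" m] W x y by auto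
  ultimately show ?thesis
    using W[OF x y]
    by (simp add: chern_deriv_def lc_deriv_def horiz_deriv_def chern_eq_conn[OF x y] conn_eq_levi_civita[OF x])
qed

lemma chern_curv_eq_riemann_curv:
  assumes "x \<in> U" "y \<noteq> 0"
  shows "chern_curv L x y u v w = riemann_curv h x u v w"
  unfolding chern_curv_def riemann_curv_def
  using chern_deriv_eq_lc_deriv[OF assms, of "chern_deriv L _ (\<lambda>_ _. w)" "lc_deriv h _ (\<lambda>_. w)"]
    chern_deriv_const by simp

end

section \<open>The fundamental tensor and the flag curvature in coordinates\<close>

text \<open>The derivative of \<open>F\<^sup>2\<close> at \<open>z\<close> in direction \<open>w\<close>, where \<open>a = \<alpha>\<^sup>2\<close> and \<open>b = \<beta>\<close> along the line \<open>z + t w\<close>; then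
  \<open>q = g(z, w)\<close> and \<open>e = \<beta>(w)\<close>.\<close>

lemma matsumoto_energy_derivative:
  fixes a b :: "real \<Rightarrow> real"
  assumes a: "(a has_real_derivative 2 * q) (at 0)" and b: "(b has_real_derivative e) (at 0)"
    and pos: "a 0 > 0" "sqrt (a 0) - b 0 > 0"
  shows "((\<lambda>t. (a t / (sqrt (a t) - b t))\<^sup>2) has_real_derivative
    4 * a 0 * q / (sqrt (a 0) - b 0)^2 - 2 * (a 0)^2 * (q / sqrt (a 0) - e) / (sqrt (a 0) - b 0)^3) (at 0)"
proof -
  have nz: "sqrt (a 0) \<noteq> 0" "sqrt (a 0) - b 0 \<noteq> 0" using pos by auto
  have s: "((\<lambda>t. sqrt (a t)) has_real_derivative inverse (sqrt (a 0)) / 2 * (2 * q)) (at 0)"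
    by (rule DERIV_chain2[OF DERIV_real_sqrt[OF pos(1)] a])
  have *: "of_nat 2 * ((2 * q * d - A * (inverse r / 2 * (2 * q) - e)) / (d * d) * (A / d) ^ (2 - Suc 0))
    = 4 * A * q / d^2 - 2 * A^2 * (q / r - e) / d^3" if "d \<noteq> 0" "r \<noteq> 0" for A r d :: real
    using that by (simp add: field_simps power2_eq_square power3_eq_cube)
  show ?thesis
    by (rule DERIV_cong[OF _ *[OF nz(2,1)]]) (intro DERIV_power DERIV_divide DERIV_diff a b s nz)
qed

text \<open>The preceding expression for \<open>z = y + t u\<close>, differentiated at \<open>t = 0\<close> for a unit vector \<open>y\<close>; here
  \<open>p = g(y, u)\<close>, \<open>f = \<beta>(u)\<close> and \<open>r = g(u, w)\<close>.\<close>

lemma matsumoto_energy_second_derivative: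
  fixes a b q :: "real \<Rightarrow> real"
  assumes a: "(a has_real_derivative 2 * p) (at 0)" and b: "(b has_real_derivative f) (at 0)"
    and q: "(q has_real_derivative r) (at 0)"
    and pos: "a 0 = 1" "1 - b 0 > 0"
  shows "((\<lambda>t. 4 * a t * q t / (sqrt (a t) - b t)^2 - 2 * (a t)^2 * (q t / sqrt (a t) - e) / (sqrt (a t) - b t)^3)
    has_real_derivative
      8 * p * q 0 / (1 - b 0)^2 + 4 * r / (1 - b 0)^2 - 8 * q 0 * (p - f) / (1 - b 0)^3
      - 8 * p * (q 0 - e) / (1 - b 0)^3 - 2 * (r - q 0 * p) / (1 - b 0)^3
      + 6 * (q 0 - e) * (p - f) / (1 - b 0)^4) (at 0)"
proof -
  have s: "((\<lambda>t. sqrt (a t)) has_real_derivative p) (at 0)"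
    using DERIV_chain2[OF DERIV_real_sqrt a] pos by simp
  define d where "d = 1 - b 0"
  define i where "i = 1 / d"
  have d: "d \<noteq> 0" "sqrt (a 0) - b 0 = d" using pos by (auto simp: d_def)
  have nz: "sqrt (a 0) \<noteq> 0" "(sqrt (a 0) - b 0)^2 \<noteq> 0" "(sqrt (a 0) - b 0)^3 \<noteq> 0" using pos d by auto
  have di: "d * i = 1" using d by (simp add: i_def)
  have div: "z / (d ^ m * d ^ n) = z * i ^ m * i ^ n" "z / d ^ n = z * i ^ n" for z m n
    by (simp_all add: i_def power_divide)
  have eq: "((4 * (2 * p) * q 0 + r * (4 * a 0)) * (sqrt (a 0) - b 0)^2
        - 4 * a 0 * q 0 * (of_nat 2 * ((p - f) * (sqrt (a 0) - b 0)^(2 - Suc 0))))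
      / ((sqrt (a 0) - b 0)^2 * (sqrt (a 0) - b 0)^2)
    - ((2 * (of_nat 2 * (2 * p * a 0 ^ (2 - Suc 0))) * (q 0 / sqrt (a 0) - e)
          + ((r * sqrt (a 0) - q 0 * p) / (sqrt (a 0) * sqrt (a 0)) - 0) * (2 * (a 0)^2)) * (sqrt (a 0) - b 0)^3
        - 2 * (a 0)^2 * (q 0 / sqrt (a 0) - e) * (of_nat 3 * ((p - f) * (sqrt (a 0) - b 0)^(3 - Suc 0))))
      / ((sqrt (a 0) - b 0)^3 * (sqrt (a 0) - b 0)^3)
    = 8 * p * q 0 / d^2 + 4 * r / d^2 - 8 * q 0 * (p - f) / d^3
      - 8 * p * (q 0 - e) / d^3 - 2 * (r - q 0 * p) / d^3 + 6 * (q 0 - e) * (p - f) / d^4"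
    unfolding d div using di
    by (simp add: pos) algebra
  show ?thesis
    by (rule DERIV_cong[OF _ eq[unfolded d_def]])
       (intro DERIV_diff DERIV_divide DERIV_mult DERIV_power DERIV_cmult DERIV_const a b q s nz)
qed

context matsumoto_berwald_chart
begin

lemma ip_line_derivative:
  "x \<in> U \<Longrightarrow> ((\<lambda>t. ip x (z + t *\<^sub>R w) (z + t *\<^sub>R w)) has_real_derivative 2 * ip x z w) (at 0)"
proof -
  assume x: "x \<in> U"
  have "ip x (z + t *\<^sub>R w) (z + t *\<^sub>R w) = ip x z z + 2 * t * ip x z w + t\<^sup>2 * ip x w w" for t
    using ip_linear_left[of x 1 z t w] ip_linear_right[of x _ 1 z t w] ip_sym[OF x, of w z]
    by (simp add: algebra_simps power2_eq_square)
  then show ?thesis by (auto intro!: derivative_eq_intros)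
qed

lemma energy_derivative:
  assumes x: "x \<in> U" and z: "z \<noteq> 0"
  shows "deriv (\<lambda>t. (L x (z + t *\<^sub>R w))\<^sup>2) 0 = 4 * ip x z z * ip x z w / (sqrt (ip x z z) - b x \<bullet> z)^2
    - 2 * (ip x z z)^2 * (ip x z w / sqrt (ip x z z) - b x \<bullet> w) / (sqrt (ip x z z) - b x \<bullet> z)^3"
proof -
  have "((\<lambda>t. b x \<bullet> (z + t *\<^sub>R w)) has_real_derivative b x \<bullet> w) (at 0)"
    by (auto simp: inner_add_right intro!: derivative_eq_intros)
  from matsumoto_energy_derivative[OF ip_line_derivative[OF x] this]
  show ?thesis
    using ip_pos[OF x z] denominator_pos[OF x z] by (simp add: matsumoto[OF x] DERIV_imp_deriv)
qed

text \<open>Here \<open>D = \<alpha> - \<beta>\<close> at the unit vector \<open>y\<close>, that is, \<open>D = 1 / F\<close>. If \<open>u\<close> is orthogonal to \<open>y\<close> and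
  annihilated by \<open>\<beta>\<close>, all terms but those with \<open>ip x u w\<close> vanish.\<close>

lemma fund_tensor_unit:
  assumes x: "x \<in> U" and y: "ip x y y = 1"
  defines "D \<equiv> 1 - b x \<bullet> y"
  shows "fund_tensor (L x) y u w = 4 * ip x y u * ip x y w / D^2 + 2 * ip x u w / D^2
    - 4 * ip x y w * (ip x y u - b x \<bullet> u) / D^3 - 4 * ip x y u * (ip x y w - b x \<bullet> w) / D^3
    - (ip x u w - ip x y w * ip x y u) / D^3 + 3 * (ip x y w - b x \<bullet> w) * (ip x y u - b x \<bullet> u) / D^4"
proof -
  have y0: "y \<noteq> 0" using y by (auto simp: ip_def)
  let ?G = "\<lambda>z. 4 * ip x z z * ip x z w / (sqrt (ip x z z) - b x \<bullet> z)^2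
    - 2 * (ip x z z)^2 * (ip x z w / sqrt (ip x z z) - b x \<bullet> w) / (sqrt (ip x z z) - b x \<bullet> z)^3"
  have "\<forall>\<^sub>F s in nhds (0::real). y + s *\<^sub>R u \<in> - {0}"
    using y0 by (intro eventually_line_in) auto
  then have "\<forall>\<^sub>F s in nhds 0. deriv (\<lambda>t. (L x (y + s *\<^sub>R u + t *\<^sub>R w))\<^sup>2) 0 = ?G (y + s *\<^sub>R u)"
    by eventually_elim (rule energy_derivative[OF x], simp)
  then have 1: "deriv (\<lambda>s. deriv (\<lambda>t. (L x (y + s *\<^sub>R u + t *\<^sub>R w))\<^sup>2) 0) 0 = deriv (\<lambda>s. ?G (y + s *\<^sub>R u)) 0"
    by (rule deriv_cong_ev) simp
  have b: "((\<lambda>t. b x \<bullet> (y + t *\<^sub>R u)) has_real_derivative b x \<bullet> u) (at 0)"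
    by (auto simp: inner_add_right intro!: derivative_eq_intros)
  have "ip x (y + t *\<^sub>R u) w = ip x y w + t * ip x u w" for t
    using ip_linear_left[of x 1 y t u w] by simp
  then have q: "((\<lambda>t. ip x (y + t *\<^sub>R u) w) has_real_derivative ip x u w) (at 0)"
    by (auto intro!: derivative_eq_intros)
  from matsumoto_energy_second_derivative[OF ip_line_derivative[OF x] b q, where e = "b x \<bullet> w"]
  have "((\<lambda>s. ?G (y + s *\<^sub>R u)) has_real_derivative
      8 * ip x y u * ip x y w / D^2 + 4 * ip x u w / D^2 - 8 * ip x y w * (ip x y u - b x \<bullet> u) / D^3
      - 8 * ip x y u * (ip x y w - b x \<bullet> w) / D^3 - 2 * (ip x u w - ip x y w * ip x y u) / D^3
      + 6 * (ip x y w - b x \<bullet> w) * (ip x y u - b x \<bullet> u) / D^4) (at 0)"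
    using denominator_pos[OF x y0] y by (simp add: D_def)
  then show ?thesis
    unfolding fund_tensor_def 1
    by (subst DERIV_imp_deriv, assumption) (simp add: algebra_simps add_divide_distrib diff_divide_distrib)
qed

text \<open>The numerator and the Gram determinant both change by the square of the determinant of the change of
  basis, the numerator because the curvature is antisymmetric in each pair of arguments.\<close>

lemma sectional_ratio:
  assumes x: "x \<in> U" and on: "ip x v v = 1" "ip x y y = 1" "ip x v y = 0"
    and u: "u = a *\<^sub>R v + a' *\<^sub>R y" and w: "w = c *\<^sub>R v + c' *\<^sub>R y" and nz: "a * c' - a' * c \<noteq> 0"
  shows "ip x (riemann_curv h x u w w) u / (ip x u u * ip x w w - (ip x u w)\<^sup>2) = ip x (riemann_curv h x v y y) v"
proof -
  have on': "ip x y v = 0" using on ip_sym[OF x] by simp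
  note lin = ip_linear_left ip_linear_right
  have gram: "ip x u u * ip x w w - (ip x u w)\<^sup>2 = (a * c' - a' * c)\<^sup>2"
    by (simp add: u w lin on on') (simp add: algebra_simps power2_eq_square)
  have z: "ip x (riemann_curv h x v y v) v = 0" "ip x (riemann_curv h x v y y) y = 0"
    "ip x (riemann_curv h x v y v) y = - ip x (riemann_curv h x v y y) v"
    using riemann_curv_antisym[OF x, of v y v v] riemann_curv_antisym[OF x, of v y y y]
      riemann_curv_antisym[OF x, of v y v y] ip_sym[OF x] by auto
  have "riemann_curv h x u w w = (a * c' - a' * c) *\<^sub>R (c *\<^sub>R riemann_curv h x v y v + c' *\<^sub>R riemann_curv h x v y y)"
    by (simp add: u w riemann_curv_change_basis[OF x] riemann_curv_linear[OF x]
        scaleR_add_right mult.commute)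
  then have "ip x (riemann_curv h x u w w) u = (a * c' - a' * c) * ip x (c *\<^sub>R riemann_curv h x v y v + c' *\<^sub>R riemann_curv h x v y y) u"
    using ip_linear_left[of x "a * c' - a' * c" _ 0 0 u] by simp
  also have "\<dots> = (a * c' - a' * c)\<^sup>2 * ip x (riemann_curv h x v y y) v"
    by (simp add: u lin z) (simp add: algebra_simps power2_eq_square)
  finally show ?thesis using nz by (simp add: gram)
qed

text \<open>The vector \<open>R(u, y)y\<close> equals \<open>a R(v, y)y\<close>; it is orthogonal to \<open>y\<close> by antisymmetry and annihilated by
  the form because the form is parallel. In terms of \<open>D = 1 / F\<close> everything becomes a polynomial
  identity, once \<open>1 / D\<close> is named \<open>i\<close> and \<open>D * i = 1\<close> is used.\<close>

lemma flag_ratio: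
  assumes x: "x \<in> U" and on: "ip x v v = 1" "ip x y y = 1" "ip x v y = 0"
    and u: "u = a *\<^sub>R v + a' *\<^sub>R y" and nz: "a \<noteq> 0"
  shows "fund_tensor (L x) y (chern_curv L x y u y y) u /
      (fund_tensor (L x) y y y * fund_tensor (L x) y u u - (fund_tensor (L x) y y u)\<^sup>2)
    = (2 - L x y) / ((L x y)\<^sup>2 * (2 * (L x y)\<^sup>2 * (b x \<bullet> v)\<^sup>2 + 2 - L x y)) * ip x (riemann_curv h x v y y) v"
proof -
  define D where "D = 1 - b x \<bullet> y"
  define \<beta> where "\<beta> = b x \<bullet> v"
  define \<kappa> where "\<kappa> = ip x (riemann_curv h x v y y) v"
  have y0: "y \<noteq> 0" using on by (auto simp: ip_def)
  have D: "D > 0" using denominator_pos[OF x y0] on by (simp add: D_def)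
  have L: "L x y = 1 / D" using matsumoto[OF x, of y] on by (simp add: D_def)
  have on': "ip x y v = 0" using on ip_sym[OF x] by simp
  have b_y: "b x \<bullet> y = 1 - D" by (simp add: D_def)
  have Hu: "ip x y u = a'" "ip x u u = a\<^sup>2 + a'\<^sup>2" "b x \<bullet> u = a * \<beta> + a' * (1 - D)"
    by (simp_all add: u ip_linear_left ip_linear_right on on' inner_add_right \<beta>_def b_y power2_eq_square)
  let ?R = "riemann_curv h x v y y"
  have "chern_curv L x y u y y = a *\<^sub>R ?R"
    using riemann_curv_change_basis[OF x, of a v a' y 0 1 y] by (simp add: chern_curv_eq_riemann_curv[OF x y0] u)
  moreover have Ry: "ip x ?R y = 0" using riemann_curv_antisym[OF x, of v y y y] ip_sym[OF x] by auto
  ultimately have R: "ip x y (chern_curv L x y u y y) = 0" "b x \<bullet> chern_curv L x y u y y = 0"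
    "ip x (chern_curv L x y u y y) u = a\<^sup>2 * \<kappa>"
    using ip_linear_right[of x y a ?R 0 0] ip_linear_left[of x a ?R 0 0 u] ip_sym[OF x, of y ?R]
    by (simp_all add: form_annihilates_curvature[OF x] u ip_linear_right \<kappa>_def power2_eq_square)
  define i where "i = 1 / D"
  have div: "z / D ^ n = z * i ^ n" for z n by (simp add: i_def power_divide)
  have Di: "D * i = 1" using D by (simp add: i_def)
  note tensor = fund_tensor_unit[OF x on(2)] D_def[symmetric] div
  have num: "fund_tensor (L x) y (chern_curv L x y u y y) u = a\<^sup>2 * \<kappa> * (2 * D - 1) * i^3"
    unfolding tensor R using Di by algebra
  have gyy: "fund_tensor (L x) y y y = i^2"
    unfolding tensor unfolding on b_y using Di by algebra
  have gyu: "fund_tensor (L x) y y u = a' * i^2 + a * \<beta> * i^3"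
    unfolding tensor unfolding on b_y Hu using Di by algebra
  have guu: "fund_tensor (L x) y u u = a\<^sup>2 * (2 * D - 1) * i^3 + a'\<^sup>2 * i^2 + 2 * a * a' * \<beta> * i^3 + 3 * a\<^sup>2 * \<beta>\<^sup>2 * i^4"
    unfolding tensor unfolding on b_y Hu using Di by algebra
  have den: "fund_tensor (L x) y y y * fund_tensor (L x) y u u - (fund_tensor (L x) y y u)\<^sup>2
     = a\<^sup>2 * (2 * D\<^sup>2 - D + 2 * \<beta>\<^sup>2) * i^6"
    unfolding gyy gyu guu using Di by algebra
  have rhs: "(2 - L x y) / ((L x y)\<^sup>2 * (2 * (L x y)\<^sup>2 * \<beta>\<^sup>2 + 2 - L x y)) = (2 * D - 1) * D^3 / (2 * D\<^sup>2 - D + 2 * \<beta>\<^sup>2)"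
  proof -
    have "2 - L x y = (2 * D - 1) / D" "(L x y)\<^sup>2 * (2 * (L x y)\<^sup>2 * \<beta>\<^sup>2 + 2 - L x y) = (2 * D\<^sup>2 - D + 2 * \<beta>\<^sup>2) / D^4"
      unfolding L using D by (simp_all add: field_simps eval_nat_numeral)
    then show ?thesis using D by (simp add: eval_nat_numeral)
  qed
  show ?thesis
    unfolding \<beta>_def[symmetric] \<kappa>_def[symmetric] rhs num den i_def using D nz
    by (simp add: power_divide eval_nat_numeral)
qed

end

section \<open>Tangent vectors and charts\<close>

lemma
  assumes "riemannian_metric A g" "c \<in> A" "p \<in> fst c"
  shows metric_tangent_sym:
      "\<xi> \<in> tangent_space A p \<Longrightarrow> \<eta> \<in> tangent_space A p \<Longrightarrow> g p \<xi> \<eta> = g p \<eta> \<xi>"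
    and metric_tangent_combination:
      "\<xi> \<in> tangent_space A p \<Longrightarrow> \<eta> \<in> tangent_space A p \<Longrightarrow> \<zeta> \<in> tangent_space A p \<Longrightarrow>
        g p (a *\<^sub>R \<xi> + b *\<^sub>R \<eta>) \<zeta> = a * g p \<xi> \<zeta> + b * g p \<eta> \<zeta>"
    and metric_tangent_pos: "\<xi> \<in> tangent_space A p \<Longrightarrow> \<xi> \<noteq> 0 \<Longrightarrow> g p \<xi> \<xi> > 0"
proof -
  have "p \<in> (\<Union>c\<in>A. fst c)" using assms(2,3) by blast
  note 1 = bspec[OF conjunct1[OF assms(1)[unfolded riemannian_metric_def]] this]
  show "g p \<xi> \<eta> = g p \<eta> \<xi>" if "\<xi> \<in> tangent_space A p" "\<eta> \<in> tangent_space A p"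
    by (rule bspec[OF bspec[OF conjunct1[OF 1]]]) (rule that)+
  show "g p (a *\<^sub>R \<xi> + b *\<^sub>R \<eta>) \<zeta> = a * g p \<xi> \<zeta> + b * g p \<eta> \<zeta>"
    if "\<xi> \<in> tangent_space A p" "\<eta> \<in> tangent_space A p" "\<zeta> \<in> tangent_space A p"
    by (rule spec[OF spec[OF bspec[OF bspec[OF bspec[OF conjunct1[OF conjunct2[OF 1]]]]]]]) (rule that)+
  show "g p \<xi> \<xi> > 0" if "\<xi> \<in> tangent_space A p" "\<xi> \<noteq> 0"
    by (rule mp[OF bspec[OF conjunct2[OF conjunct2[OF 1]]]]) (rule that)+
qed

lemma
  assumes "finsler_metric A F" "c \<in> A" "p \<in> fst c" "\<xi> \<in> tangent_space A p"
  shows finsler_nonneg: "F p \<xi> \<ge> 0"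
    and finsler_homogeneous: "r > 0 \<Longrightarrow> F p (r *\<^sub>R \<xi>) = r * F p \<xi>"
proof -
  have "p \<in> (\<Union>c\<in>A. fst c)" using assms(2,3) by blast
  note 1 = bspec[OF bspec[OF conjunct1[OF assms(1)[unfolded finsler_metric_def]] this] assms(4)]
  show "F p \<xi> \<ge> 0" by (rule conjunct1[OF 1])
  show "F p (r *\<^sub>R \<xi>) = r * F p \<xi>" if "r > 0" using conjunct2[OF 1] that by blast
qed

locale manifold =
  fixes T :: "'a topology" and A :: "('a, real^'n) chart set"
  assumes smooth_manifold: "smooth_manifold T A"
begin

lemma chart_props:
  assumes "c \<in> A"
  shows open_chart_domain: "openin T (fst c)"
    and open_chart_image: "open (chart_image c)"
    and chart_homeomorphic: "homeomorphic_map (subtopology T (fst c)) (top_of_set (chart_image c)) (snd c)"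
  using smooth_manifold assms unfolding smooth_manifold_def by blast+

lemma smooth_transition:
  "c \<in> A \<Longrightarrow> d \<in> A \<Longrightarrow> smooth_on (snd d \<circ> chart_pt c) (snd c ` (fst c \<inter> fst d))"
  using smooth_manifold unfolding smooth_manifold_def by blast

lemma chart_domain_subset: "c \<in> A \<Longrightarrow> fst c \<subseteq> topspace T"
  by (rule openin_subset[OF open_chart_domain])

lemma inj_on_chart: "c \<in> A \<Longrightarrow> inj_on (snd c) (fst c)"
  using homeomorphic_imp_injective_map[OF chart_homeomorphic] chart_domain_subset
  by (simp add: topspace_subtopology inf_absorb2)

lemma chart_pt_chart: "c \<in> A \<Longrightarrow> p \<in> fst c \<Longrightarrow> chart_pt c (snd c p) = p"
  unfolding chart_pt_def using inj_on_chart by (rule inv_into_f_f)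

lemma chart_chart_pt: "x \<in> chart_image c \<Longrightarrow> snd c (chart_pt c x) = x"
  unfolding chart_pt_def chart_image_def by (rule f_inv_into_f)

lemma chart_pt_in: "x \<in> chart_image c \<Longrightarrow> chart_pt c x \<in> fst c"
  unfolding chart_pt_def chart_image_def by (rule inv_into_into)

lemma chart_in_image: "p \<in> fst c \<Longrightarrow> snd c p \<in> chart_image c"
  by (simp add: chart_image_def)

lemma open_overlap:
  assumes "c \<in> A" "d \<in> A"
  shows "open (snd c ` (fst c \<inter> fst d))"
proof -
  have "openin (subtopology T (fst c)) (fst c \<inter> fst d)"
    unfolding openin_subtopology by (intro exI[of _ "fst d"]) (simp add: inf_commute open_chart_domain[OF assms(2)])
  then have "openin (top_of_set (chart_image c)) (snd c ` (fst c \<inter> fst d))"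
    using homeomorphic_imp_open_map[OF chart_homeomorphic[OF assms(1)]] by (simp add: open_map_def)
  then show ?thesis using open_chart_image[OF assms(1)] openin_open_eq by blast
qed

lemma differentiable_transition:
  assumes "c \<in> A" "d \<in> A" "p \<in> fst c" "p \<in> fst d"
  shows "(snd d \<circ> chart_pt c) differentiable at (snd c p)"
  by (rule smooth_on_imp_differentiable[OF smooth_transition[OF assms(1,2)]]) (use assms in blast)

lemma frechet_derivative_transition_self:
  assumes "c \<in> A" "p \<in> fst c"
  shows "frechet_derivative (snd c \<circ> chart_pt c) (at (snd c p)) w = w"
proof -
  have "dird w (snd c \<circ> chart_pt c) (snd c p) = dird w (\<lambda>x. x) (snd c p)"
    by (rule dird_cong[OF open_chart_image[OF assms(1)] chart_in_image[OF assms(2)]])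
       (simp add: chart_chart_pt)
  then show ?thesis by (simp add: dird_def)
qed

text \<open>The chain rule for transition maps, which satisfy the cocycle identity on the overlap only; this is
  why the overlap must be open.\<close>

lemma frechet_derivative_transition_compose:
  assumes "c \<in> A" "d \<in> A" "e \<in> A" "p \<in> fst c" "p \<in> fst d" "p \<in> fst e"
  shows "frechet_derivative (snd e \<circ> chart_pt c) (at (snd c p)) w
    = frechet_derivative (snd e \<circ> chart_pt d) (at (snd d p)) (frechet_derivative (snd d \<circ> chart_pt c) (at (snd c p)) w)"
proof -
  have p: "(snd d \<circ> chart_pt c) (snd c p) = snd d p" using assms by (simp add: chart_pt_chart)
  have e: "dird w (snd e \<circ> chart_pt c) (snd c p) = dird w ((snd e \<circ> chart_pt d) \<circ> (snd d \<circ> chart_pt c)) (snd c p)"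
  proof (rule dird_cong[OF open_overlap[OF assms(1,2)]])
    show "snd c p \<in> snd c ` (fst c \<inter> fst d)" using assms by blast
    show "(snd e \<circ> chart_pt c) z = ((snd e \<circ> chart_pt d) \<circ> (snd d \<circ> chart_pt c)) z"
      if "z \<in> snd c ` (fst c \<inter> fst d)" for z
      using that assms by (auto simp: chart_pt_chart)
  qed
  have d: "(snd e \<circ> chart_pt d) differentiable at ((snd d \<circ> chart_pt c) (snd c p))"
    unfolding p using assms by (intro differentiable_transition)
  show ?thesis
    using e[unfolded dird_def frechet_derivative_compose[OF differentiable_transition[OF assms(1,2,4,5)] d] p]
    by (rule trans) (rule o_apply)
qed

context
  fixes c p assumes c: "c \<in> A" and p: "p \<in> fst c"
begin

lemma chart_vec_nth:
  "d \<in> A \<Longrightarrow> p \<in> fst d \<Longrightarrow> chart_vec A c p w d = frechet_derivative (snd d \<circ> chart_pt c) (at (snd c p)) w"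
  by (simp only: chart_vec_def simp_thms if_True)

lemma chart_vec_self: "chart_vec A c p w c = w"
  unfolding chart_vec_nth[OF c p] by (rule frechet_derivative_transition_self[OF c p])

lemma chart_vec_outside: "\<not> (d \<in> A \<and> p \<in> fst d) \<Longrightarrow> chart_vec A c p w d = 0"
  by (simp only: chart_vec_def if_False)

text \<open>The cocycle identity for the derivatives of the transition maps is the transformation law of tangent
  vectors.\<close>

lemma chart_vec_tangent: "chart_vec A c p w \<in> tangent_space A p"
  unfolding tangent_space_def
proof (intro CollectI conjI ballI allI impI)
  fix d e assume d: "d \<in> A" "p \<in> fst d" and e: "e \<in> A" "p \<in> fst e"
  show "chart_vec A c p w e = frechet_derivative (snd e \<circ> chart_pt d) (at (snd d p)) (chart_vec A c p w d)"
    unfolding chart_vec_nth[OF d] chart_vec_nth[OF e]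
    by (rule frechet_derivative_transition_compose[OF c d(1) e(1) p d(2) e(2)])
qed (rule chart_vec_outside)

lemma chart_vec_of_tangent:
  assumes "\<xi> \<in> tangent_space A p" shows "chart_vec A c p (\<xi> c) = \<xi>"
proof
  fix d
  show "chart_vec A c p (\<xi> c) d = \<xi> d"
  proof (cases "d \<in> A \<and> p \<in> fst d")
    case True
    then have d: "d \<in> A" "p \<in> fst d" by auto
    have "\<xi> d = frechet_derivative (snd d \<circ> chart_pt c) (at (snd c p)) (\<xi> c)"
      using assms c p d unfolding tangent_space_def by blast
    then show ?thesis unfolding chart_vec_nth[OF d] by (rule HOL.sym)
  next
    case False
    then have "\<xi> d = 0" using assms unfolding tangent_space_def by blast
    then show ?thesis using chart_vec_outside[OF False] by simp
  qed
qed

lemma chart_vec_linear: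
  "chart_vec A c p (r *\<^sub>R v + s *\<^sub>R w) = r *\<^sub>R chart_vec A c p v + s *\<^sub>R chart_vec A c p w"
proof
  fix d
  show "chart_vec A c p (r *\<^sub>R v + s *\<^sub>R w) d = (r *\<^sub>R chart_vec A c p v + s *\<^sub>R chart_vec A c p w) d"
  proof (cases "d \<in> A \<and> p \<in> fst d")
    case True
    then have d: "d \<in> A" "p \<in> fst d" by auto
    note lin = linear_frechet_derivative[OF differentiable_transition[OF c d(1) p d(2)]]
    show ?thesis
      by (simp only: chart_vec_nth[OF d] scaleR_fun_def plus_fun_apply linear_add[OF lin] linear_cmul[OF lin])
  next
    case False
    then show ?thesis by (simp add: chart_vec_outside scaleR_fun_def)
  qed
qed

text \<open>Bilinearity of the metric on the tangent space, expanded in the coordinate basis.\<close>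

lemma coord_metric_eq:
  assumes g: "riemannian_metric A g"
  shows "g p (chart_vec A c p v) (chart_vec A c p w) = v \<bullet> (coord_metric A c g (snd c p) *v w)"
proof -
  let ?\<phi> = "\<lambda>v w. g p (chart_vec A c p v) (chart_vec A c p w)"
  have sym: "?\<phi> v w = ?\<phi> w v" for v w
    by (rule metric_tangent_sym[OF g c p chart_vec_tangent chart_vec_tangent])
  have comb: "?\<phi> (r *\<^sub>R v + s *\<^sub>R v') w = r * ?\<phi> v w + s * ?\<phi> v' w" for r s v v' w
    unfolding chart_vec_linear
    by (rule metric_tangent_combination[OF g c p chart_vec_tangent chart_vec_tangent chart_vec_tangent])
  have lin: "linear (\<lambda>v. ?\<phi> v w)" for w
    by (rule linearI) (use comb[of 1 _ 1 _ w] comb[of _ _ 0 0 w] in simp_all)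
  have lin': "linear (?\<phi> v)" for v
  proof -
    have "?\<phi> v = (\<lambda>w. ?\<phi> w v)" by (rule ext) (rule sym)
    then show ?thesis using lin[of v] by simp
  qed
  have ex: "z = (\<Sum>i\<in>UNIV. z $ i *\<^sub>R axis i 1)" for z :: "real^'n"
    by (simp add: basis_expansion[of z, unfolded scalar_mult_eq_scaleR])
  have "?\<phi> v w = (\<Sum>i\<in>UNIV. v $ i * ?\<phi> (axis i 1) w)"
    by (subst (1) ex[of v]) (simp only: linear_sum[OF lin] linear_cmul[OF lin] real_scaleR_def)
  also have "\<dots> = (\<Sum>i\<in>UNIV. v $ i * (\<Sum>j\<in>UNIV. w $ j * ?\<phi> (axis i 1) (axis j 1)))"
    by (subst (1) ex[of w]) (simp only: linear_sum[OF lin'] linear_cmul[OF lin'] real_scaleR_def)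
  also have "\<dots> = v \<bullet> (coord_metric A c g (snd c p) *v w)"
    using c p by (simp add: inner_vec_def matrix_vector_mult_def coord_metric_def chart_pt_chart mult.commute)
  finally show ?thesis .
qed

end

lemma metric_tangent:
  assumes "riemannian_metric A g" "c \<in> A" "p \<in> fst c" "\<xi> \<in> tangent_space A p" "\<eta> \<in> tangent_space A p"
  shows "g p \<xi> \<eta> = \<xi> c \<bullet> (coord_metric A c g (snd c p) *v \<eta> c)"
  using coord_metric_eq[OF assms(2,3,1), of "\<xi> c" "\<eta> c"] chart_vec_of_tangent assms by simp

lemma riemannian_chart:
  assumes g: "riemannian_metric A g" and c: "c \<in> A"
  shows "riemannian_chart (coord_metric A c g) (chart_image c)"
proof
  show "open (chart_image c)" by (rule open_chart_image[OF c])
  show "smooth_on (\<lambda>x. coord_metric A c g x $ i $ j) (chart_image c)" for i j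
    using g c by (simp add: riemannian_metric_def)
  fix x assume x: "x \<in> chart_image c"
  then have p: "chart_pt c x \<in> fst c" "snd c (chart_pt c x) = x"
    by (simp_all add: chart_pt_in chart_chart_pt)
  show "coord_metric A c g x $ i $ j = coord_metric A c g x $ j $ i" for i j
    using metric_tangent_sym[OF g c p(1) chart_vec_tangent[OF c p(1)] chart_vec_tangent[OF c p(1)]]
    by (simp add: coord_metric_def)
  fix w :: "real^'n" assume "w \<noteq> 0"
  then have nz: "chart_vec A c (chart_pt c x) w \<noteq> 0"
    using chart_vec_self[OF c p(1), of w] by (metis zero_fun_apply)
  then show "0 < w \<bullet> (coord_metric A c g x *v w)"
    using metric_tangent_pos[OF g c p(1) chart_vec_tangent[OF c p(1)] nz]
      coord_metric_eq[OF c p(1) g, of w w, unfolded p(2)] by linarith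
qed

lemma local_finsler:
  assumes F: "finsler_metric A F" and c: "c \<in> A"
  shows "local_finsler (coord_finsler A c F) (chart_image c)"
proof
  show "open (chart_image c)" by (rule open_chart_image[OF c])
  show "smooth_on (\<lambda>(x, y). coord_finsler A c F x y) (chart_image c \<times> (UNIV - {0}))"
    using F c by (simp add: finsler_metric_def)
  fix x assume x: "x \<in> chart_image c"
  then have p: "chart_pt c x \<in> fst c" by (rule chart_pt_in)
  show "coord_finsler A c F x (r *\<^sub>R y) = r * coord_finsler A c F x y" if "0 < r" for r y
    using finsler_homogeneous[OF F c p chart_vec_tangent[OF c p] that, of y] chart_vec_linear[OF c p, of r y 0 0]
    by (simp add: coord_finsler_def)
  show "w \<bullet> (fund_matrix (coord_finsler A c F) x y *v w) > 0" if "y \<noteq> 0" "w \<noteq> 0" for y w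
    using F c x that by (simp add: finsler_metric_def)
qed

text \<open>The components of the form \<open>g(X, \<cdot>)\<close>.\<close>

definition coord_form where
  "coord_form c g X x = coord_metric A c g x *v X (chart_pt c x) c"

lemma matsumoto_berwald_chart:
  assumes g: "riemannian_metric A g" and X: "vector_field A X" and F: "finsler_metric A (matsumoto g X)"
    and B: "berwald_type A (matsumoto g X)" and c: "c \<in> A"
  shows "matsumoto_berwald_chart (coord_metric A c g) (coord_finsler A c (matsumoto g X)) (chart_image c) (coord_form c g X)"
proof -
  interpret R: riemannian_chart "coord_metric A c g" "chart_image c" by (rule riemannian_chart[OF g c])
  interpret local_finsler "coord_finsler A c (matsumoto g X)" "chart_image c" by (rule local_finsler[OF F c])
  show ?thesis
  proof
    show "smooth_on (\<lambda>x. coord_form c g X x $ j) (chart_image c)" for j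
      unfolding coord_form_def matrix_vector_mult_def using X c
      by (auto intro!: smooth_on_sum smooth_on_mult open_chart_image smooth_on_vec_nth
          R.smooth_metric simp: vector_field_def)
    fix x assume x: "x \<in> chart_image c"
    then have p: "chart_pt c x \<in> fst c" "snd c (chart_pt c x) = x"
      by (simp_all add: chart_pt_in chart_chart_pt)
    have Xp: "X (chart_pt c x) \<in> tangent_space A (chart_pt c x)"
      using X c p(1) unfolding vector_field_def by blast
    show "coord_finsler A c (matsumoto g X) x y = R.ip x y y / (sqrt (R.ip x y y) - coord_form c g X x \<bullet> y)" for y
    proof -
      have "g (chart_pt c x) (X (chart_pt c x)) (chart_vec A c (chart_pt c x) y) = R.ip x (X (chart_pt c x) c) y"
        using metric_tangent[OF g c p(1) Xp chart_vec_tangent[OF c p(1)]]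
        by (simp add: R.ip_def p(2) chart_vec_self[OF c p(1)])
      also have "\<dots> = coord_form c g X x \<bullet> y"
        unfolding R.ip_sym[OF x, of _ y] by (simp add: R.ip_def coord_form_def inner_commute)
      finally show ?thesis
        using coord_metric_eq[OF c p(1) g, of y y] p(2)
        by (simp add: coord_finsler_def matsumoto_def R.ip_def)
    qed
    show "0 \<le> coord_finsler A c (matsumoto g X) x y" for y
      unfolding coord_finsler_def by (rule finsler_nonneg[OF F c p(1) chart_vec_tangent[OF c p(1)]])
    show "chern (coord_finsler A c (matsumoto g X)) i j k x y = chern (coord_finsler A c (matsumoto g X)) i j k x y'"
      if "y \<noteq> 0" "y' \<noteq> 0" for i j k y y'
      using B c x that unfolding berwald_type_def by blast
  qed
qed

end

section \<open>The flag curvature formula\<close>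

lemma span_pair_combination:
  assumes "u \<in> span {v, y}" obtains a b where "u = a *\<^sub>R v + b *\<^sub>R y"
proof -
  obtain a where "u - a *\<^sub>R v \<in> span {y}" using assms by (auto simp: span_insert)
  then obtain b where "u - a *\<^sub>R v = b *\<^sub>R y" by (auto simp: span_singleton)
  then have "u = a *\<^sub>R v + b *\<^sub>R y" by (simp add: diff_eq_eq add.commute)
  then show thesis by (rule that)
qed

theorem theorem3p2:
  fixes G :: "('a, 'm) monoid_scheme"
    and T :: "'a topology"
    and A :: "('a, real^'n) chart set"
    and g :: "'a \<Rightarrow> ('a, real^'n) tvec \<Rightarrow> ('a, real^'n) tvec \<Rightarrow> real"
    and X :: "'a \<Rightarrow> ('a, real^'n) tvec"
    and F :: "'a \<Rightarrow> ('a, real^'n) tvec \<Rightarrow> real"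
    and c :: "('a, real^'n) chart"
    and P :: "('a, real^'n) tvec set"
    and y v :: "('a, real^'n) tvec"
  assumes "lie_group G T A"
    and "riemannian_metric A g" and "left_invariant_metric G A g"
    and "vector_field A X" and "left_invariant_field G A X"
    and "F = matsumoto g X"
    and "finsler_metric A F" and "left_invariant_finsler G A F"
    and "berwald_type A F"
    and "flag A \<one>\<^bsub>G\<^esub> P y"
    and "span {v, y} = P"
    and "g \<one>\<^bsub>G\<^esub> v v = 1" and "g \<one>\<^bsub>G\<^esub> y y = 1" and "g \<one>\<^bsub>G\<^esub> v y = 0"
    and "c \<in> A" and "\<one>\<^bsub>G\<^esub> \<in> fst c"
  shows "flag_curvature A c F \<one>\<^bsub>G\<^esub> P y =
    (2 - F \<one>\<^bsub>G\<^esub> y)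
      / ((F \<one>\<^bsub>G\<^esub> y)\<^sup>2 * (2 * (F \<one>\<^bsub>G\<^esub> y)\<^sup>2 * (g \<one>\<^bsub>G\<^esub> (X \<one>\<^bsub>G\<^esub>) v)\<^sup>2 + 2 - F \<one>\<^bsub>G\<^esub> y))
    * sectional_curvature A c g \<one>\<^bsub>G\<^esub> P"
proof -
  note g = assms(2) and c = assms(15) and p = assms(16)
  interpret manifold T A using assms(1) by unfold_locales (simp add: lie_group_def)
  let ?p = "\<one>\<^bsub>G\<^esub>" and ?x = "snd c \<one>\<^bsub>G\<^esub>"
  let ?h = "coord_metric A c g" and ?L = "coord_finsler A c F" and ?b = "coord_form c g X"
  interpret M: matsumoto_berwald_chart ?h ?L "chart_image c" ?b
    using matsumoto_berwald_chart[OF g assms(4) _ _ c] assms(6,7,9) by simp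
  have x: "?x \<in> chart_image c" using p by (rule chart_in_image)
  have pt: "chart_pt c ?x = ?p" by (rule chart_pt_chart[OF c p])
  have tan: "u \<in> tangent_space A ?p" if "u \<in> P" for u
    using assms(10) that by (auto simp: flag_def)
  have vyP: "v \<in> P" "y \<in> P" using assms(11) span_base[of _ "{v, y}"] by auto
  have ip: "g ?p \<xi> \<eta> = M.ip ?x (\<xi> c) (\<eta> c)" if "\<xi> \<in> tangent_space A ?p" "\<eta> \<in> tangent_space A ?p" for \<xi> \<eta>
    using metric_tangent[OF g c p that] by (simp add: M.ip_def)
  have on: "M.ip ?x (v c) (v c) = 1" "M.ip ?x (y c) (y c) = 1" "M.ip ?x (v c) (y c) = 0"
    using ip tan vyP assms(12-14) by auto
  have on': "M.ip ?x (y c) (v c) = 0" using on M.ip_sym[OF x] by simp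
  have Fy: "F ?p y = ?L ?x (y c)"
    using chart_vec_of_tangent[OF c p tan[OF vyP(2)]] by (simp add: coord_finsler_def pt)
  have "X ?p \<in> tangent_space A ?p" using assms(4) c p by (auto simp: vector_field_def)
  then have Xv: "g ?p (X ?p) v = ?b ?x \<bullet> v c"
    using ip[OF _ tan[OF vyP(1)]] M.ip_sym[OF x, of "X ?p c"] by (simp add: coord_form_def pt M.ip_def inner_commute)
  have comb: "(a *\<^sub>R v + b *\<^sub>R y) c = a *\<^sub>R v c + b *\<^sub>R y c" for a b
    by (simp add: scaleR_fun_def)
  \<comment> \<open>Two vectors that span the plane of \<open>v\<close> and \<open>y\<close> have a coefficient matrix that is inverse to the one
    expressing \<open>v\<close> and \<open>y\<close> by them, so its determinant is nonzero.\<close>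
  have nondeg: "a * b' - b * a' \<noteq> 0"
    if uw: "span {u, w} = P" and u: "u = a *\<^sub>R v + b *\<^sub>R y" and w: "w = a' *\<^sub>R v + b' *\<^sub>R y" for u w a b a' b'
  proof -
    obtain q r where vq: "v = q *\<^sub>R u + r *\<^sub>R w"
      using vyP(1)[folded uw] by (rule span_pair_combination)
    obtain s t where ys: "y = s *\<^sub>R u + t *\<^sub>R w"
      using vyP(2)[folded uw] by (rule span_pair_combination)
    have v1: "q * a + r * a' = 1" "q * b + r * b' = 0"
    proof -
      have "v c = (q * a + r * a') *\<^sub>R v c + (q * b + r * b') *\<^sub>R y c"
        using arg_cong[OF vq[unfolded u w], of "\<lambda>f. f c"] by (simp add: scaleR_fun_def algebra_simps)
      then have "M.ip ?x (v c) z = (q * a + r * a') * M.ip ?x (v c) z + (q * b + r * b') * M.ip ?x (y c) z" for z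
        by (metis M.ip_linear_left)
      from this[of "v c"] this[of "y c"] show "q * a + r * a' = 1" "q * b + r * b' = 0"
        by (simp_all add: on on')
    qed
    have y1: "s * a + t * a' = 0" "s * b + t * b' = 1"
    proof -
      have "y c = (s * a + t * a') *\<^sub>R v c + (s * b + t * b') *\<^sub>R y c"
        using arg_cong[OF ys[unfolded u w], of "\<lambda>f. f c"] by (simp add: scaleR_fun_def algebra_simps)
      then have "M.ip ?x (y c) z = (s * a + t * a') * M.ip ?x (v c) z + (s * b + t * b') * M.ip ?x (y c) z" for z
        by (metis M.ip_linear_left)
      from this[of "v c"] this[of "y c"] show "s * a + t * a' = 0" "s * b + t * b' = 1"
        by (simp_all add: on on')
    qed
    have "(q * t - r * s) * (a * b' - b * a') = 1" using v1 y1 by algebra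
    then show ?thesis by auto
  qed
  define \<kappa> where "\<kappa> = M.ip ?x (riemann_curv ?h ?x (v c) (y c) (y c)) (v c)"
  have sect: "sectional_curvature A c g ?p P = \<kappa>"
    unfolding sectional_curvature_def Let_def
  proof (rule the_equality)
    show *: "\<forall>u w. span {u, w} = P \<longrightarrow> \<kappa> = riemann_curv ?h ?x (u c) (w c) (w c) \<bullet> (?h ?x *v u c) /
       (u c \<bullet> (?h ?x *v u c) * (w c \<bullet> (?h ?x *v w c)) - (u c \<bullet> (?h ?x *v w c))\<^sup>2)"
    proof (intro allI impI)
      fix u w assume uw: "span {u, w} = P"
      then have "u \<in> span {v, y}" "w \<in> span {v, y}" using assms(11) span_base[of _ "{u, w}"] by auto
      then obtain a b a' b' where ab: "u = a *\<^sub>R v + b *\<^sub>R y" "w = a' *\<^sub>R v + b' *\<^sub>R y"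
        by (elim span_pair_combination)
      show "\<kappa> = riemann_curv ?h ?x (u c) (w c) (w c) \<bullet> (?h ?x *v u c) /
       (u c \<bullet> (?h ?x *v u c) * (w c \<bullet> (?h ?x *v w c)) - (u c \<bullet> (?h ?x *v w c))\<^sup>2)"
        using M.sectional_ratio[OF x on, of "u c" a b "w c" a' b'] nondeg[OF uw ab] ab comb
        by (simp add: \<kappa>_def M.ip_def)
    qed
    then show "K = \<kappa>" if "\<forall>u w. span {u, w} = P \<longrightarrow> K = riemann_curv ?h ?x (u c) (w c) (w c) \<bullet> (?h ?x *v u c) /
       (u c \<bullet> (?h ?x *v u c) * (w c \<bullet> (?h ?x *v w c)) - (u c \<bullet> (?h ?x *v w c))\<^sup>2)" for K
      using that assms(11) by metis
  qed
  let ?ratio = "\<lambda>u. fund_tensor (?L ?x) (y c) (chern_curv ?L ?x (y c) (u c) (y c) (y c)) (u c) /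
      (fund_tensor (?L ?x) (y c) (y c) (y c) * fund_tensor (?L ?x) (y c) (u c) (u c) - (fund_tensor (?L ?x) (y c) (y c) (u c))\<^sup>2)"
  define K where "K = (2 - F ?p y) / ((F ?p y)\<^sup>2 * (2 * (F ?p y)\<^sup>2 * (g ?p (X ?p) v)\<^sup>2 + 2 - F ?p y)) * \<kappa>"
  have ratio: "K = ?ratio u" if u: "span {u, y} = P" for u
  proof -
    have "u \<in> span {v, y}" using assms(11) u span_base[of _ "{u, y}"] by auto
    then obtain a b where ab: "u = a *\<^sub>R v + b *\<^sub>R y" by (rule span_pair_combination)
    have "a \<noteq> 0" using nondeg[OF u ab, of 0 1] by simp
    then show ?thesis
      using M.flag_ratio[OF x on, of "u c" a b] ab comb by (simp add: K_def \<kappa>_def Fy Xv)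
  qed
  have "flag_curvature A c F ?p P y = K"
    unfolding flag_curvature_def Let_def
  proof (rule the_equality)
    show "\<forall>u. span {u, y} = P \<longrightarrow> K = ?ratio u" using ratio by blast
    show "K' = K" if "\<forall>u. span {u, y} = P \<longrightarrow> K' = ?ratio u" for K'
      using that ratio[OF assms(11)] assms(11) by simp
  qed
  then show ?thesis by (simp add: K_def sect)
qed

end
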